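(* Let $G$ be a connected graph and let $D \subseteq V(G)$ be a connected three-way dominating set of $G$. Then $rx_3(G) \le rx_3(G[D]) + 6$. Moreover, the bound is tight: there exist a connected graph $G$ and a connected three-way dominating set $D$ of $G$ such that $rx_3(G) = rx_3(G[D]) + 6$.
   Context: All graphs are undirected, finite, simple and nonempty. An edge-coloring of a graph assigns a color to each edge; adjacent edges may receive the same color. A tree (subgraph) in an edge-colored graph is rainbow if no two of its edges have the same color. An edge-coloring of a connected graph $H$ is a 3-rainbow coloring if for every set $S$ of three vertices of $H$ there is a rainbow tree in $H$ whose vertex set contains $S$. The 3-rainbow index $rx_3(H)$ is the minimum number of colors in a 3-rainbow coloring of $H$. Convention for graphs with fewer than three vertices: the condition is required for all sets $S$ of at most three vertices, so that the one-vertex graph has $rx_3 = 0$ and $rx_3(K_2)=1$ (for connected graphs with at least three vertices this makes no difference). $G[D]$ denotes the subgraph of $G$ induced by $D$. A set $D \subseteq V(G)$ is a dominating set if every vertex of $V(G)\setminus D$ is adjacent to at least one vertex of $D$. A dominating set $D$ is a three-way dominating set if every vertex $v \in V(G)\setminus D$ has degree at least $3$ in $G$; it is a connected three-way dominating set if in addition $G[D]$ is connected (and nonempty). *)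

theory Defs
  imports Main
begin

record 'a ugraph =
  verts :: "'a set"
  edges :: "'a set set"

definition simple_graph :: "'a ugraph \<Rightarrow> bool" where
  "simple_graph G \<longleftrightarrow> finite (verts G) \<and> verts G \<noteq> {} \<and>
     (\<forall>e\<in>edges G. e \<subseteq> verts G \<and> card e = 2)"

definition adj :: "'a ugraph \<Rightarrow> 'a \<Rightarrow> 'a \<Rightarrow> bool" where
  "adj G u v \<longleftrightarrow> {u, v} \<in> edges G"

definition degree :: "'a ugraph \<Rightarrow> 'a \<Rightarrow> nat" where
  "degree G v = card {u. adj G v u}"

definition connected_graph :: "'a ugraph \<Rightarrow> bool" where
  "connected_graph G \<longleftrightarrow> simple_graph G \<and>
     (\<forall>u\<in>verts G. \<forall>v\<in>verts G. (adj G)\<^sup>*\<^sup>* u v)"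

text \<open>A cycle is given by its vertices in cyclic order, without repeating the first one.\<close>

definition is_cycle :: "'a ugraph \<Rightarrow> 'a list \<Rightarrow> bool" where
  "is_cycle G xs \<longleftrightarrow> 3 \<le> length xs \<and> distinct xs \<and>
     (\<forall>i<length xs. adj G (xs ! i) (xs ! (Suc i mod length xs)))"

definition is_tree :: "'a ugraph \<Rightarrow> bool" where
  "is_tree T \<longleftrightarrow> connected_graph T \<and> (\<nexists>xs. is_cycle T xs)"

definition subgraph :: "'a ugraph \<Rightarrow> 'a ugraph \<Rightarrow> bool" where
  "subgraph H G \<longleftrightarrow> simple_graph H \<and> verts H \<subseteq> verts G \<and> edges H \<subseteq> edges G"

definition induced_subgraph :: "'a ugraph \<Rightarrow> 'a set \<Rightarrow> 'a ugraph" where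
  "induced_subgraph G D = \<lparr>verts = D, edges = {e \<in> edges G. e \<subseteq> D}\<rparr>"

text \<open>A coloring is a function on all two-element sets, of which only the values on
  \<open>edges G\<close> matter; adjacent edges may get the same color.\<close>

definition rainbow_tree :: "'a ugraph \<Rightarrow> ('a set \<Rightarrow> nat) \<Rightarrow> 'a ugraph \<Rightarrow> bool" where
  "rainbow_tree G c T \<longleftrightarrow> subgraph T G \<and> is_tree T \<and> inj_on c (edges T)"

text \<open>Requiring the condition for all sets of at most three vertices fixes the convention for
  graphs with fewer than three vertices; see \<open>rainbow3_coloring_iff\<close> for all other graphs.\<close>

definition rainbow3_coloring :: "'a ugraph \<Rightarrow> ('a set \<Rightarrow> nat) \<Rightarrow> bool" where
  "rainbow3_coloring G c \<longleftrightarrow>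
     (\<forall>S \<subseteq> verts G. card S \<le> 3 \<longrightarrow> (\<exists>T. rainbow_tree G c T \<and> S \<subseteq> verts T))"

text \<open>Meaningful for connected graphs only: otherwise no \<open>rainbow3_coloring\<close> exists.\<close>

definition rx3 :: "'a ugraph \<Rightarrow> nat" where
  "rx3 G = (LEAST k. \<exists>c. rainbow3_coloring G c \<and> card (c ` edges G) = k)"

definition dominating_set :: "'a ugraph \<Rightarrow> 'a set \<Rightarrow> bool" where
  "dominating_set G D \<longleftrightarrow> D \<subseteq> verts G \<and> (\<forall>v\<in>verts G - D. \<exists>u\<in>D. adj G v u)"

definition three_way_dominating_set :: "'a ugraph \<Rightarrow> 'a set \<Rightarrow> bool" where
  "three_way_dominating_set G D \<longleftrightarrow>
     dominating_set G D \<and> (\<forall>v\<in>verts G - D. 3 \<le> degree G v)"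

text \<open>Nonemptiness of \<open>D\<close> is part of \<open>connected_graph\<close>.\<close>

definition connected_three_way_dominating_set :: "'a ugraph \<Rightarrow> 'a set \<Rightarrow> bool" where
  "connected_three_way_dominating_set G D \<longleftrightarrow>
     three_way_dominating_set G D \<and> connected_graph (induced_subgraph G D)"

lemma rainbow3_coloring_iff:
  assumes G: "simple_graph G" and c3: "3 \<le> card (verts G)"
  shows "rainbow3_coloring G c \<longleftrightarrow>
    (\<forall>S \<subseteq> verts G. card S = 3 \<longrightarrow> (\<exists>T. rainbow_tree G c T \<and> S \<subseteq> verts T))"
    (is "_ \<longleftrightarrow> ?R")
proof
  assume R: ?R
  show "rainbow3_coloring G c"
    unfolding rainbow3_coloring_def
  proof (intro allI impI)
    fix S assume S: "S \<subseteq> verts G" "card S \<le> 3"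
    obtain S' where S': "S \<subseteq> S'" "S' \<subseteq> verts G" "card S' = 3"
      using exists_subset_between[OF S(2) c3 S(1)] G
      unfolding simple_graph_def by blast
    from R[rule_format, OF S'(2,3)] obtain T where "rainbow_tree G c T" "S' \<subseteq> verts T"
      by (elim exE conjE)
    with S'(1) show "\<exists>T. rainbow_tree G c T \<and> S \<subseteq> verts T"
      by (intro exI[of _ T] conjI) (assumption, rule subset_trans)
  qed
qed (simp add: rainbow3_coloring_def)

lemma singleton_is_tree: "is_tree \<lparr>verts = {v}, edges = {}\<rparr>"
proof -
  have "\<not> is_cycle \<lparr>verts = {v}, edges = {}\<rparr> xs" for xs
  proof
    assume "is_cycle \<lparr>verts = {v}, edges = {}\<rparr> xs"
    then have "3 \<le> length xs" "\<forall>i. \<not> i < length xs"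
      by (simp_all add: is_cycle_def adj_def)
    then show False by (metis not_numeral_le_zero gr0I)
  qed
  then show ?thesis
    by (auto simp: is_tree_def connected_graph_def simple_graph_def)
qed

lemma rx3_K1: "rx3 \<lparr>verts = {v}, edges = {}\<rparr> = 0"
proof -
  have "rainbow_tree \<lparr>verts = {v}, edges = {}\<rparr> c \<lparr>verts = {v}, edges = {}\<rparr>" for c
    using singleton_is_tree[of v]
    by (simp add: rainbow_tree_def subgraph_def is_tree_def connected_graph_def)
  then have "rainbow3_coloring \<lparr>verts = {v}, edges = {}\<rparr> c" for c
    unfolding rainbow3_coloring_def by fastforce
  then show ?thesis
    by (simp add: rx3_def)
qed

lemma rx3_K2:
  assumes "u \<noteq> v"
  shows "rx3 \<lparr>verts = {u, v}, edges = {{u, v}}\<rparr> = 1"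
proof -
  let ?K = "\<lparr>verts = {u, v}, edges = {{u, v}}\<rparr>"
  have s: "simple_graph ?K"
    using assms by (simp add: simple_graph_def)
  have a: "adj ?K u v" "adj ?K v u"
    by (auto simp: adj_def)
  have "\<not> is_cycle ?K xs" for xs
  proof
    assume cyc: "is_cycle ?K xs"
    have "set xs \<subseteq> {u, v}"
    proof
      fix x assume "x \<in> set xs"
      then obtain i where "i < length xs" "x = xs ! i"
        by (auto simp: in_set_conv_nth)
      with cyc have "adj ?K x (xs ! (Suc i mod length xs))"
        unfolding is_cycle_def by blast
      then show "x \<in> {u, v}"
        by (auto simp: adj_def doubleton_eq_iff)
    qed
    then have "card (set xs) \<le> card {u, v}" by (intro card_mono) auto
    also have "\<dots> \<le> 2" using assms by simp
    finally show False
      using cyc by (auto simp: is_cycle_def distinct_card)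
  qed
  moreover have "connected_graph ?K"
    unfolding connected_graph_def using s r_into_rtranclp[of "adj ?K"] a by simp
  ultimately have "is_tree ?K"
    by (simp add: is_tree_def)
  with s have "rainbow_tree ?K c ?K" for c
    by (simp add: rainbow_tree_def subgraph_def)
  then have "rainbow3_coloring ?K c" for c
    unfolding rainbow3_coloring_def by fastforce
  then have "rx3 ?K = (LEAST k. k = 1)"
    unfolding rx3_def by (simp add: eq_commute)
  then show ?thesis by (simp add: Least_equality)
qed

end

theory Submission
  imports Defs "HOL-Library.FuncSet"
begin

text \<open>
  Let \<open>U = V - D\<close>. An optimal coloring of \<open>G[D]\<close> is extended by three new colors for the legs, i.e. the
  edges between \<open>U\<close> and \<open>D\<close>, and three more for the edges inside \<open>U\<close>, both indexed by 0, 1, 2. It is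
  enough that every vertex of \<open>U\<close> is flexible: for some ordering \<open>h, j, k\<close> of the indices it has
  a leg of color \<open>h\<close>, an exit through a leg of color \<open>k\<close> whose other edges have color \<open>j\<close>, and an exit through
  a leg of color \<open>j\<close> whose other edges avoid color \<open>j\<close>. Any three flexible vertices have exits
  with pairwise disjoint colors, and a rainbow tree of \<open>G[D]\<close> joins the ends of these exits.

  To make all vertices flexible, give a vertex at distance \<open>d\<close> from the root of its component
  of \<open>G[U]\<close> the leg color \<open>d mod 3\<close>; its parent and its children then supply the two other leg
  colors. A vertex without children and with a single leg has either a second neighbor one level
  up, through which it reaches the leg color of its grandparents' level, or a neighbor on its own
  level; in the latter case a maximal independent set \<open>M\<close> of such vertices changes its leg color to \<open>d + 1\<close>.

  The bound is attained by many copies of \<open>K4\<close> sharing one vertex, which forms \<open>D\<close>. With five colors,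
  three copies would be colored alike by the pigeonhole principle, and joining the three copies of
  each vertex forces the six edges of these copies to have distinct colors.
\<close>

subsection \<open>Rainbow trees\<close>

abbreviation joined :: "'a set set \<Rightarrow> 'a \<Rightarrow> 'a \<Rightarrow> bool" where
  "joined F \<equiv> (\<lambda>a b. {a, b} \<in> F)\<^sup>*\<^sup>*"

lemma joined_sym: "joined F a b \<Longrightarrow> joined F b a"
  by (rule sympD[OF symp_rtranclp]) (auto simp: symp_def insert_commute)

lemma joined_mono: "joined F a b \<Longrightarrow> F \<subseteq> F' \<Longrightarrow> joined F' a b"
  by (erule rtranclp_mono[THEN predicate2D, rotated]) auto

lemma adj_eq: "adj G = (\<lambda>a b. {a, b} \<in> edges G)"
  by (auto simp: adj_def fun_eq_iff)

lemma simple_graph_finite_edges: "simple_graph G \<Longrightarrow> finite (edges G)"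
  by (rule finite_subset[of _ "Pow (verts G)"]) (auto simp: simple_graph_def)

text \<open>The other edges of the cycle form a path between the ends of \<open>e\<close>, so every
  use of \<open>e\<close> can be rerouted along it.\<close>

lemma joined_remove_cycle_edge:
  assumes cyc: "is_cycle T xs" and e: "e = {xs ! (length xs - 1), xs ! 0}"
    and j: "joined (edges T) a b"
  shows "joined (edges T - {e}) a b"
proof -
  let ?n = "length xs" and ?E = "edges T - {e}"
  from cyc have n: "3 \<le> ?n" and d: "distinct xs"
    and ad: "\<And>i. i < ?n \<Longrightarrow> {xs ! i, xs ! (Suc i mod ?n)} \<in> edges T"
    by (auto simp: is_cycle_def adj_def)
  have path: "k < ?n \<Longrightarrow> joined ?E (xs ! 0) (xs ! k)" for k
  proof (induction k)
    case (Suc k)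
    have "{xs ! k, xs ! Suc k} \<in> edges T"
      using ad[of k] Suc.prems by simp
    moreover have "{xs ! k, xs ! Suc k} \<noteq> e"
    proof
      assume "{xs ! k, xs ! Suc k} = e"
      then have "(xs ! k = xs ! (?n - 1) \<and> xs ! Suc k = xs ! 0) \<or> (xs ! k = xs ! 0 \<and> xs ! Suc k = xs ! (?n - 1))"
        by (simp add: e doubleton_eq_iff)
      moreover have "xs ! Suc k \<noteq> xs ! 0"
        using d Suc.prems n by (subst nth_eq_iff_index_eq) auto
      ultimately have "xs ! k = xs ! 0" "xs ! Suc k = xs ! (?n - 1)" by auto
      moreover have "0 < ?n" "?n - 1 < ?n" using n by auto
      ultimately have "k = 0 \<and> Suc k = ?n - 1"
        using nth_eq_iff_index_eq[OF d] Suc.prems Suc_lessD by metis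
      with n show False by auto
    qed
    ultimately have "{xs ! k, xs ! Suc k} \<in> ?E" by simp
    then show ?case using Suc by (simp add: rtranclp.rtrancl_into_rtrancl)
  qed simp
  have last: "joined ?E (xs ! 0) (xs ! (?n - 1))"
    using n by (intro path) auto
  have edge: "joined ?E u v" if "{u, v} \<in> edges T" for u v
  proof (cases "{u, v} = e")
    case True
    then have "(u = xs ! 0 \<and> v = xs ! (?n - 1)) \<or> (v = xs ! 0 \<and> u = xs ! (?n - 1))"
      by (auto simp: e doubleton_eq_iff)
    then show ?thesis using last joined_sym[OF last] by auto
  qed (use that in auto)
  from j show ?thesis
  proof induction
    case (step y z)
    from step.IH edge[OF step.hyps(2)] show ?case by (rule rtranclp_trans)
  qed simp
qed

text \<open>A minimal subset of \<open>F\<close> that still joins \<open>d\<close> to all of \<open>S\<close> is a tree.\<close>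

lemma rainbow_tree_of_joined:
  assumes G: "simple_graph G" and F: "F \<subseteq> edges G" and inj: "inj_on c F"
    and d: "d \<in> verts G" and S: "\<And>s. s \<in> S \<Longrightarrow> joined F d s"
  shows "\<exists>T. rainbow_tree G c T \<and> S \<subseteq> verts T"
proof -
  have finF: "finite F" using simple_graph_finite_edges[OF G] F by (rule rev_finite_subset)
  define \<A> where "\<A> = {F'. F' \<subseteq> F \<and> (\<forall>s\<in>S. joined F' d s)}"
  have "finite \<A>" "\<A> \<noteq> {}" using finF S by (auto simp: \<A>_def)
  from finite_has_minimal[OF this] obtain F0 where F0: "F0 \<in> \<A>"
    and min: "\<And>F'. F' \<in> \<A> \<Longrightarrow> F' \<subseteq> F0 \<Longrightarrow> F0 = F'" by metis
  from F0 have F0F: "F0 \<subseteq> F" and F0S: "\<And>s. s \<in> S \<Longrightarrow> joined F0 d s" by (auto simp: \<A>_def)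
  \<comment> \<open>A priori \<open>F0\<close> may have edges that are not connected to
    \<open>d\<close>; restricting to \<open>W\<close> makes connectedness of \<open>T\<close>
    immediate.\<close>
  define W where "W = {v. joined F0 d v}"
  define T where "T = \<lparr>verts = W, edges = {e \<in> F0. e \<subseteq> W}\<rparr>"
  have TF: "edges T \<subseteq> F" using F0F by (auto simp: T_def)
  have JT: "joined (edges T) d v" if "v \<in> W" for v
  proof -
    from that have "joined F0 d v" by (simp add: W_def)
    then show ?thesis
    proof induction
      case (step y z)
      then have "{y, z} \<in> edges T"
        using rtranclp.rtrancl_into_rtrancl[OF step.hyps] by (simp add: T_def W_def)
      with step.IH show ?case by (rule rtranclp.rtrancl_into_rtrancl)
    qed simp
  qed
  have SW: "S \<subseteq> W" using F0S by (auto simp: W_def)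
  have dW: "d \<in> W" by (simp add: W_def)
  have WV: "W \<subseteq> verts G"
  proof
    fix v assume "v \<in> W"
    then have "joined F0 d v" by (simp add: W_def)
    then show "v \<in> verts G"
    proof induction
      case (step y z)
      then have "{y, z} \<subseteq> verts G" using G F0F F unfolding simple_graph_def by blast
      then show ?case by simp
    qed (rule d)
  qed
  have simp: "simple_graph T"
    using G WV dW F0F F finite_subset[OF WV] by (auto simp: simple_graph_def T_def)
  have "joined (edges T) u v" if "u \<in> W" "v \<in> W" for u v
    using JT[OF that(2)] joined_sym[OF JT[OF that(1)]] by (rule rtranclp_trans[rotated])
  then have conn: "connected_graph T"
    using simp by (auto simp: connected_graph_def adj_eq T_def)
  have "\<not> is_cycle T xs" for xs
  proof
    assume cyc: "is_cycle T xs"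
    define e where "e = {xs ! (length xs - 1), xs ! 0}"
    have eT: "e \<in> edges T"
    proof -
      have 3: "3 \<le> length xs" using cyc by (simp add: is_cycle_def)
      then have l: "length xs - 1 < length xs" by simp
      with cyc have "adj T (xs ! (length xs - 1)) (xs ! (Suc (length xs - 1) mod length xs))"
        unfolding is_cycle_def by blast
      moreover have "Suc (length xs - 1) = length xs" using 3 by simp
      ultimately show ?thesis by (simp add: e_def adj_def)
    qed
    \<comment> \<open>Dropping an edge of a cycle keeps \<open>S\<close> joined to \<open>d\<close>,
      against the minimality of \<open>F0\<close>.\<close>
    have "edges T - {e} \<in> \<A>"
      unfolding \<A>_def using TF joined_remove_cycle_edge[OF cyc e_def JT[OF subsetD[OF SW]]] by blast
    moreover have "edges T - {e} \<subseteq> F0" by (auto simp: T_def)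
    ultimately have "F0 = edges T - {e}" by (rule min)
    moreover have "e \<in> F0" using eT by (simp add: T_def)
    ultimately show False by blast
  qed
  then have "is_tree T" using conn by (simp add: is_tree_def)
  then have "rainbow_tree G c T"
    using simp WV TF F inj_on_subset[OF inj TF] by (auto simp: rainbow_tree_def subgraph_def T_def)
  moreover have "S \<subseteq> verts T" using SW by (simp add: T_def)
  ultimately show ?thesis by blast
qed

text \<open>Pairwise distinct edge colors give a 3-rainbow coloring, so the \<open>LEAST\<close> in
  \<open>rx3\<close> ranges over a nonempty set.\<close>

lemma rx3_attained:
  assumes "connected_graph G"
  obtains c where "rainbow3_coloring G c" "card (c ` edges G) = rx3 G"
proof -
  have G: "simple_graph G" using assms by (simp add: connected_graph_def)
  obtain c :: "'a set \<Rightarrow> nat" where c: "inj_on c (edges G)"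
    using finite_imp_inj_to_nat_seg[OF simple_graph_finite_edges[OF G]] by blast
  obtain d where d: "d \<in> verts G" using G by (auto simp: simple_graph_def)
  have "rainbow3_coloring G c"
    unfolding rainbow3_coloring_def
    by (intro allI impI rainbow_tree_of_joined[OF G subset_refl c d])
      (use assms d in \<open>auto simp: connected_graph_def adj_eq\<close>)
  then have "\<exists>k c. rainbow3_coloring G c \<and> card (c ` edges G) = k" by blast
  from LeastI_ex[OF this] show ?thesis
    using that unfolding rx3_def by blast
qed

subsection \<open>Disjoint exits\<close>

text \<open>\<open>X j B\<close> reads: the vertex has an exit to \<open>D\<close> whose last edge has leg color \<open>j\<close> and whose
  other edges have colors in \<open>B\<close>.\<close>

definition flexible :: "(nat \<Rightarrow> nat set \<Rightarrow> bool) \<Rightarrow> bool" where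
  "flexible X \<longleftrightarrow> (\<exists>h j k. {h, j, k} = {0, 1, 2} \<and> X h {} \<and> X k {j} \<and> X j {h, k})"

text \<open>Leg colors and colors inside \<open>U\<close> come from different palettes, so a leg
  color such as \<open>a\<close> may well be an element of \<open>B\<close> or
  \<open>C\<close>.\<close>

definition compatible :: "(nat \<Rightarrow> nat set \<Rightarrow> bool) \<Rightarrow> (nat \<Rightarrow> nat set \<Rightarrow> bool) \<Rightarrow> (nat \<Rightarrow> nat set \<Rightarrow> bool) \<Rightarrow> bool"
  where "compatible X Y Z \<longleftrightarrow> (\<exists>a b e A B C. a < 3 \<and> b < 3 \<and> e < 3 \<and> a \<noteq> b \<and> b \<noteq> e \<and> a \<noteq> e \<and>
    A \<inter> B = {} \<and> B \<inter> C = {} \<and> A \<inter> C = {} \<and> X a A \<and> Y b B \<and> Z e C)"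

lemma compatibleI:
  assumes "X a A" "Y b B" "Z e C" "a < 3 \<and> b < 3 \<and> e < 3 \<and> a \<noteq> b \<and> b \<noteq> e \<and> a \<noteq> e"
    "A \<inter> B = {}" "B \<inter> C = {}" "A \<inter> C = {}"
  shows "compatible X Y Z"
  unfolding compatible_def
  by (intro exI[of _ a] exI[of _ b] exI[of _ e] exI[of _ A] exI[of _ B] exI[of _ C])
    (use assms in simp)

lemma index_triple:
  "{a, b, c} = {0, 1, 2 :: nat} \<longleftrightarrow> a < 3 \<and> b < 3 \<and> c < 3 \<and> a \<noteq> b \<and> b \<noteq> c \<and> a \<noteq> c"
proof
  assume e: "{a, b, c} = {0, 1, 2}"
  have "card {a, b, c} = 3" unfolding e by simp
  then have d: "a \<noteq> b" "b \<noteq> c" "a \<noteq> c" by (auto simp: card_insert_if split: if_splits)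
  have "{a, b, c} \<subseteq> {..<3}" unfolding e by auto
  with d show "a < 3 \<and> b < 3 \<and> c < 3 \<and> a \<noteq> b \<and> b \<noteq> c \<and> a \<noteq> c" by simp
next
  assume a: "a < 3 \<and> b < 3 \<and> c < 3 \<and> a \<noteq> b \<and> b \<noteq> c \<and> a \<noteq> c"
  have "{a, b, c} = {..<3}" using a by (intro card_subset_eq) auto
  also have "\<dots> = {0, 1, 2}" by auto
  finally show "{a, b, c} = {0, 1, 2}" .
qed

lemma third_index:
  "a < 3 \<and> b < 3 \<and> c < 3 \<and> a \<noteq> b \<and> b \<noteq> c \<and> a \<noteq> c \<Longrightarrow> m < 3 \<Longrightarrow> m = a \<or> m = b \<or> m = (c :: nat)"
  by linarith

text \<open>If two of \<open>h\<close>, \<open>h'\<close>, \<open>h''\<close> differ, two vertices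
  leave through their own legs without inner edges, and the third takes a remaining leg color with
  whatever inner colors this needs. Only three equal leg colors require the finer conditions in
  \<open>flexible\<close>.\<close>

lemma compatible_of_flexible:
  assumes "flexible X" "flexible Y" "flexible Z"
  shows "compatible X Y Z"
proof -
  obtain h j k where x: "h < 3 \<and> j < 3 \<and> k < 3 \<and> h \<noteq> j \<and> j \<noteq> k \<and> h \<noteq> k"
    and X: "X h {}" "X k {j}" "X j {h, k}"
    using assms(1) unfolding flexible_def index_triple by blast
  obtain h' j' k' where y: "h' < 3 \<and> j' < 3 \<and> k' < 3 \<and> h' \<noteq> j' \<and> j' \<noteq> k' \<and> h' \<noteq> k'"
    and Y: "Y h' {}" "Y k' {j'}" "Y j' {h', k'}"
    using assms(2) unfolding flexible_def index_triple by blast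
  obtain h'' j'' k'' where z: "h'' < 3 \<and> j'' < 3 \<and> k'' < 3 \<and> h'' \<noteq> j'' \<and> j'' \<noteq> k'' \<and> h'' \<noteq> k''"
    and Z: "Z h'' {}" "Z k'' {j''}" "Z j'' {h'', k''}"
    using assms(3) unfolding flexible_def index_triple by blast
  have any: "\<exists>A. W m A" if W: "flexible W" and m: "m < 3" for W m
  proof -
    obtain a b c where abc: "a < 3 \<and> b < 3 \<and> c < 3 \<and> a \<noteq> b \<and> b \<noteq> c \<and> a \<noteq> c"
      and "W a {}" "W c {b}" "W b {a, c}"
      using W unfolding flexible_def index_triple by blast
    moreover have "m = a \<or> m = b \<or> m = c" using third_index[OF abc m] .
    ultimately show ?thesis by blast
  qed
  have third: "\<exists>m<3. a \<noteq> m \<and> b \<noteq> m" for a b :: nat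
  proof -
    have "card {a, b} \<le> 2" by (simp add: card_insert_if)
    then have "\<not> {..<3} \<subseteq> {a, b}" using card_mono[of "{a, b}" "{..<3}"] by auto
    then show ?thesis by auto
  qed
  consider "h = h'" "h' = h''" | "h = h'" "h'' \<noteq> h" | "h = h''" "h' \<noteq> h" | "h' = h''" "h \<noteq> h'"
    | "h \<noteq> h'" "h' \<noteq> h''" "h \<noteq> h''" by blast
  then show ?thesis
  proof cases
    case 1
    show ?thesis
    proof (cases "k' = k''")
      case True
      \<comment> \<open>Equal orderings: the second vertex exits by \<open>j'\<close> with inner
        colors \<open>h'\<close>, \<open>k'\<close>, the third by \<open>k''\<close> with inner
        color \<open>j''\<close>.\<close>
      then have "j' = j''" using 1 z third_index[OF y, of j''] by metis
      with 1 True x y show ?thesis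
        by (intro compatibleI[of X _ _ Y _ _ Z, OF X(1) Y(3) Z(2)]) auto
    next
      case False
      \<comment> \<open>Opposite orderings: both take their \<open>k\<close> exits, whose single
        inner colors differ.\<close>
      then have "k'' = j'" "j'' = k'" using 1 y z third_index[OF y, of k''] third_index[OF z, of k'] by metis+
      with 1 x y show ?thesis
        by (intro compatibleI[of X _ _ Y _ _ Z, OF X(1) Y(2) Z(2)]) auto
    qed
  next
    case 2
    obtain m where m: "m < 3" "h \<noteq> m" "h'' \<noteq> m" using third by blast
    obtain A where "Y m A" using any[OF assms(2) m(1)] by blast
    then show ?thesis by (rule compatibleI[of X _ _ Y _ _ Z, OF X(1) _ Z(1)]) (use x y z m 2 in auto)
  next
    case 3
    obtain m where m: "m < 3" "h \<noteq> m" "h' \<noteq> m" using third by blast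
    obtain A where "Z m A" using any[OF assms(3) m(1)] by blast
    then show ?thesis by (rule compatibleI[of X _ _ Y _ _ Z, OF X(1) Y(1)]) (use x y z m 3 in auto)
  next
    case 4
    obtain m where m: "m < 3" "h \<noteq> m" "h' \<noteq> m" using third by blast
    obtain A where "Z m A" using any[OF assms(3) m(1)] by blast
    then show ?thesis by (rule compatibleI[of X _ _ Y _ _ Z, OF X(1) Y(1)]) (use x y z m 4 in auto)
  next
    case 5
    then show ?thesis by (intro compatibleI[of X _ _ Y _ _ Z, OF X(1) Y(1) Z(1)]) (use x y z in auto)
  qed
qed

subsection \<open>Levels\<close>

text \<open>\<open>R\<close> is adjacency outside \<open>D\<close>, \<open>P v\<close> is the set of colors of the legs of \<open>v\<close>, and \<open>b\<close> colors the
  edges outside \<open>D\<close>. Exits through at most two such edges suffice.\<close>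

definition exit :: "('a \<Rightarrow> 'a \<Rightarrow> bool) \<Rightarrow> ('a \<Rightarrow> nat set) \<Rightarrow> ('a \<Rightarrow> 'a \<Rightarrow> nat) \<Rightarrow> 'a \<Rightarrow> nat \<Rightarrow> nat set \<Rightarrow> bool" where
  "exit R P b v j B \<longleftrightarrow> j \<in> P v \<or> (\<exists>u. R v u \<and> b v u \<in> B \<and> j \<in> P u) \<or>
     (\<exists>u w. R v u \<and> R u w \<and> b v u \<in> B \<and> b u w \<in> B \<and> b v u \<noteq> b u w \<and> j \<in> P w)"

text \<open>\<open>n v\<close> stands for the number of legs of \<open>v\<close>.\<close>

locale legged_graph =
  fixes U :: "'a set" and R :: "'a \<Rightarrow> 'a \<Rightarrow> bool" and n :: "'a \<Rightarrow> nat"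
  assumes fin: "finite U"
    and R_sym: "R u v \<Longrightarrow> R v u"
    and R_irrefl: "\<not> R v v"
    and R_closed: "R u v \<Longrightarrow> u \<in> U"
    and n_pos: "v \<in> U \<Longrightarrow> 1 \<le> n v"
    and deg: "v \<in> U \<Longrightarrow> 3 \<le> n v + card {u. R v u}"
begin

lemma R_closed': "R u v \<Longrightarrow> v \<in> U"
  using R_closed R_sym by blast

text \<open>Levels are distances from a root of each component. A root with \<open>n\<close>
  different from 1 is chosen whenever the component has such a vertex, which gives the last
  property.\<close>

lemma levels:
  obtains root level where "\<And>u v. R u v \<Longrightarrow> root u = root v"
    "\<And>u v. R u v \<Longrightarrow> level v \<le> Suc (level u)"
    "\<And>v. level v = 0 \<Longrightarrow> root v = v"
    "\<And>v d. level v = Suc d \<Longrightarrow> \<exists>u. R v u \<and> level u = d"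
    "\<And>v. n (root v) = 1 \<Longrightarrow> n v = 1"
proof -
  define good where "good v r \<longleftrightarrow> R\<^sup>*\<^sup>* v r \<and> (n r = 1 \<longrightarrow> (\<forall>u. R\<^sup>*\<^sup>* v u \<longrightarrow> n u = 1))" for v r
  define root where "root v = (SOME r. good v r)" for v
  have sym: "R\<^sup>*\<^sup>* u v \<Longrightarrow> R\<^sup>*\<^sup>* v u" for u v
    by (rule sympD[OF symp_rtranclp]) (auto simp: symp_def R_sym)
  have "\<exists>r. good v r" for v
  proof (cases "\<exists>u. R\<^sup>*\<^sup>* v u \<and> n u \<noteq> 1")
    case False
    then have "good v v" by (auto simp: good_def)
    then show ?thesis by blast
  qed (auto simp: good_def)
  then have good: "good v (root v)" for v unfolding root_def by (rule someI_ex)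
  have "R\<^sup>*\<^sup>* u = R\<^sup>*\<^sup>* v" if "R u v" for u v
    using that R_sym[OF that] by (auto simp: fun_eq_iff intro: converse_rtranclp_into_rtranclp)
  \<comment> \<open>Neighbors reach the same vertices and so have the same predicate
    \<open>good\<close>; hence \<open>SOME\<close> returns the same root.\<close>
  then have root_eq: "root u = root v" if "R u v" for u v
    using that by (simp add: root_def good_def)
  define level where "level v = (LEAST m. (R ^^ m) (root v) v)" for v
  have "\<exists>m. (R ^^ m) (root v) v" for v
    using good[of v] sym[of v "root v"] by (auto simp: good_def rtranclp_power)
  then have level: "(R ^^ level v) (root v) v" for v
    unfolding level_def by (rule LeastI_ex)
  have level_le: "level v \<le> m" if "(R ^^ m) (root v) v" for v m
    unfolding level_def using that by (rule Least_le)
  have step: "level v \<le> Suc (level u)" if "R u v" for u v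
  proof (rule level_le)
    show "(R ^^ Suc (level u)) (root v) v"
      using level[of u] that root_eq[OF that] by auto
  qed
  have root: "root v = v" if "level v = 0" for v
    using level[of v] that by simp
  have up: "\<exists>u. R v u \<and> level u = d" if d: "level v = Suc d" for v d
  proof -
    from level[of v] d obtain u where u: "(R ^^ d) (root v) u" "R u v" by auto
    then have "level u \<le> d" by (intro level_le) (simp add: root_eq[OF u(2)])
    with step[OF u(2)] d have "level u = d" by simp
    with u(2) show ?thesis by (blast intro: R_sym)
  qed
  have one: "n v = 1" if "n (root v) = 1" for v
    using good[of v] that by (auto simp: good_def)
  show thesis by (rule that[OF root_eq step root up one])
qed

end

locale leveled_graph = legged_graph +
  fixes root :: "'a \<Rightarrow> 'a" and level :: "'a \<Rightarrow> nat"
  assumes root_eq: "R u v \<Longrightarrow> root u = root v"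
    and level_step: "R u v \<Longrightarrow> level v \<le> Suc (level u)"
    and root_root: "level v = 0 \<Longrightarrow> root v = v"
    and level_up: "level v = Suc d \<Longrightarrow> \<exists>u. R v u \<and> level u = d"
    and n_root: "n (root v) = 1 \<Longrightarrow> n v = 1"
begin

text \<open>These vertices miss the leg color \<open>level v + 1\<close>, as they have no neighbor one level down to supply it.\<close>

definition pending :: "'a set" where
  "pending = {v \<in> U. n v = 1 \<and> 0 < level v \<and> \<not> (\<exists>u. R v u \<and> level u = Suc (level v)) \<and> (\<exists>u. R v u \<and> level u = level v)}"

lemma ex_maximal_independent:
  obtains M where "M \<subseteq> pending" "\<And>u v. u \<in> M \<Longrightarrow> v \<in> M \<Longrightarrow> R u v \<Longrightarrow> level u \<noteq> level v"
    "\<And>v. v \<in> pending - M \<Longrightarrow> \<exists>u\<in>M. R v u \<and> level u = level v"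
proof -
  define \<A> where "\<A> = {M. M \<subseteq> pending \<and> (\<forall>u\<in>M. \<forall>v\<in>M. R u v \<longrightarrow> level u \<noteq> level v)}"
  have "\<A> \<subseteq> Pow U" by (auto simp: \<A>_def pending_def)
  then have "finite \<A>" using fin by (simp add: finite_subset)
  moreover have "\<A> \<noteq> {}" by (auto simp: \<A>_def)
  ultimately obtain M where M: "M \<in> \<A>" and max: "\<And>N. N \<in> \<A> \<Longrightarrow> M \<subseteq> N \<Longrightarrow> M = N"
    using finite_has_maximal[of \<A>] by metis
  have "\<exists>u\<in>M. R v u \<and> level u = level v" if v: "v \<in> pending - M" for v
  proof (rule ccontr)
    assume no: "\<not> ?thesis"
    have "insert v M \<in> \<A>"
    proof -
      have "level x \<noteq> level y" if xy: "x \<in> insert v M" "y \<in> insert v M" "R x y" for x y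
      proof -
        consider "x = v" "y = v" | "x = v" "y \<in> M" | "x \<in> M" "y = v" | "x \<in> M" "y \<in> M"
          using xy by blast
        then show ?thesis
        proof cases
          case 1
          with xy(3) R_irrefl show ?thesis by blast
        next
          case 2
          with xy(3) no show ?thesis by metis
        next
          case 3
          with R_sym[OF xy(3)] no show ?thesis by metis
        next
          case 4
          with xy(3) M show ?thesis unfolding \<A>_def by blast
        qed
      qed
      with v M show ?thesis unfolding \<A>_def by blast
    qed
    then show False using max[of "insert v M"] v by blast
  qed
  with M show thesis by (intro that[of M]) (auto simp: \<A>_def)
qed

text \<open>A vertex of level 0 is its own root and neighbors share their root, so two such vertices
  are never adjacent.\<close>

lemma root_nbr:
  assumes "level r = 0" "R r u"
  shows "level u = 1" and "root u = r"
proof -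
  show "root u = r" using assms root_eq root_root by metis
  have "level u \<noteq> 0" using \<open>root u = r\<close> root_root assms(2) R_irrefl by metis
  with level_step[OF assms(2)] assms(1) show "level u = 1" by simp
qed

lemma level1_root: "level u = 1 \<Longrightarrow> R (root u) u \<and> level (root u) = 0"
  using level_up[of u 0] root_nbr R_sym by (metis One_nat_def)

end

section \<open>Leg colors and edge colors relative to the independent set \<open>M\<close>\<close>

locale moved_graph = leveled_graph +
  fixes M :: "'a set"
  assumes M_pending: "M \<subseteq> pending"
    and M_indep: "u \<in> M \<Longrightarrow> v \<in> M \<Longrightarrow> R u v \<Longrightarrow> level u \<noteq> level v"
    and M_max: "v \<in> pending - M \<Longrightarrow> \<exists>u\<in>M. R v u \<and> level u = level v"
begin

lemma M_n: "v \<in> M \<Longrightarrow> n v = 1" and M_level: "v \<in> M \<Longrightarrow> 0 < level v"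
  using M_pending by (auto simp: pending_def)

text \<open>The neighbor on its own level that a pending vertex has by definition is kept out of
  \<open>M\<close> by independence.\<close>

lemma M_partner: "v \<in> M \<Longrightarrow> \<exists>u. R v u \<and> level u = level v \<and> u \<notin> M"
  using M_pending M_indep unfolding pending_def by fastforce

text \<open>Pending vertices have no children.\<close>

lemma up_notin_M: "R v u \<Longrightarrow> level v = Suc (level u) \<Longrightarrow> u \<notin> M"
  using M_pending R_sym unfolding pending_def by blast

text \<open>A root with a single leg reaches leg color 2 through a neighbor in \<open>M\<close>. If there is none, it does
  so through its neighbor \<open>branch r\<close> and a vertex of level 2.\<close>

definition needy :: "'a \<Rightarrow> bool" where
  "needy r \<longleftrightarrow> r \<in> U \<and> level r = 0 \<and> n r = 1 \<and> \<not> (\<exists>v\<in>M. R r v)"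

definition branch :: "'a \<Rightarrow> 'a" where
  "branch r = (SOME c. R r c \<and> level c = 1 \<and> (\<exists>w. R c w \<and> level w = 2 \<and> w \<notin> M))"

text \<open>With a single leg, at least two of the three required neighbors are in
  \<open>U\<close>.\<close>

lemma two_nbrs:
  assumes "v \<in> U" "n v = 1"
  obtains u where "R v u" "u \<noteq> x"
proof -
  have "2 \<le> card {u. R v u}" using deg[OF assms(1)] assms(2) by simp
  moreover have "card {x} = 1" by simp
  ultimately have "\<not> {u. R v u} \<subseteq> {x}" using card_mono[of "{x}" "{u. R v u}"] by auto
  then show thesis using that by blast
qed

text \<open>All vertices in the component of a needy root have a single leg. A neighbor
  \<open>u\<close> of the root without a neighbor of level 2 would have one of level 1 and be
  pending; by maximality it would then have a neighbor in \<open>M\<close> of level 1, which is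
  adjacent to the root as well. A vertex of level 2 that lies in \<open>M\<close> is replaced by its
  partner.\<close>

lemma branch:
  assumes "needy r"
  shows "R r (branch r) \<and> level (branch r) = 1 \<and> (\<exists>w. R (branch r) w \<and> level w = 2 \<and> w \<notin> M)"
proof -
  from assms have r: "r \<in> U" "level r = 0" "n r = 1" "\<And>v. R r v \<Longrightarrow> v \<notin> M" by (auto simp: needy_def)
  obtain u where u: "R r u" using two_nbrs[OF r(1,3)] by blast
  note u' = root_nbr[OF r(2) u]
  have n1: "n x = 1" if "root x = r" for x using n_root[of x] r that by simp
  have uU: "u \<in> U" using u by (rule R_closed')
  obtain w0 where w0: "R u w0" "level w0 = 2"
  proof (cases "\<exists>w. R u w \<and> level w = 2")
    case False
    obtain x where x: "R u x" "x \<noteq> r" using two_nbrs[OF uU n1[OF u'(2)]] by blast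
    have "root x = r" using root_eq[OF x(1)] u' by simp
    then have "level x \<noteq> 0" using x(2) root_root by metis
    moreover have "level x \<noteq> 2" using False x(1) by blast
    ultimately have "level x = 1" using level_step[OF x(1)] u' by simp
    then have "u \<in> pending" using uU n1[OF u'(2)] u' False x(1) by (auto simp: pending_def numeral_2_eq_2)
    moreover have "u \<notin> M" using r(4) u by blast
    ultimately obtain y where y: "y \<in> M" "R u y" "level y = 1" using M_max[of u] u' by auto
    have "root y = r" using root_eq[OF y(2)] u' by simp
    then have "R r y" using level1_root[OF y(3)] by simp
    with y(1) r(4) show ?thesis by blast
  qed blast
  obtain w where w: "level w = 2" "w \<notin> M" "root w = r"
  proof (cases "w0 \<in> M")
    case True
    then obtain w where "R w0 w" "level w = level w0" "w \<notin> M" using M_partner by blast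
    with w0 u' root_eq that show ?thesis by metis
  next
    case False
    with w0 u' root_eq that show ?thesis by metis
  qed
  \<comment> \<open>After this replacement \<open>w\<close> need not be adjacent to
    \<open>u\<close>, so a new upward neighbor of \<open>w\<close> is the witness.\<close>
  obtain c where c: "R w c" "level c = 1" using level_up[of w 1] w(1) by (auto simp: numeral_2_eq_2)
  have "root c = r" using root_eq[OF c(1)] w(3) by simp
  then have "R r c" using level1_root[OF c(2)] by simp
  then have "\<exists>c. R r c \<and> level c = 1 \<and> (\<exists>w. R c w \<and> level w = 2 \<and> w \<notin> M)"
    using c w R_sym by blast
  then show ?thesis unfolding branch_def by (rule someI_ex)
qed

text \<open>Parents are arbitrary, except that the neighbors of a branch on level 2 take it as
  parent. This gives their edges to the branch color 0 and keeps the second upward neighbor in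
  \<open>reach_second_up\<close> from being special.\<close>

definition parent :: "'a \<Rightarrow> 'a" where
  "parent v = (if needy (root v) \<and> R v (branch (root v)) \<and> level v = 2 then branch (root v)
     else SOME u. R v u \<and> level v = Suc (level u))"

lemma parent:
  assumes "level v = Suc d"
  shows "R v (parent v)" "level (parent v) = d" "parent v \<notin> M"
proof -
  have "\<exists>u. R v u \<and> level v = Suc (level u)" using level_up[OF assms] assms by auto
  then have "R v (SOME u. R v u \<and> level v = Suc (level u)) \<and> level v = Suc (level (SOME u. R v u \<and> level v = Suc (level u)))"
    by (rule someI_ex)
  then have *: "R v (parent v) \<and> level v = Suc (level (parent v))"
    using branch[of "root v"] by (auto simp: parent_def)
  then show "R v (parent v)" "level (parent v) = d" "parent v \<notin> M" using assms up_notin_M by auto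
qed

text \<open>The edge from a special vertex to its root gets color 1 instead of 2, which frees 2 for the
  edge by which the root reaches leg color 1.\<close>

definition special :: "'a set" where
  "special = {v. level v = 1 \<and> (v \<in> M \<or> needy (root v) \<and> v = branch (root v))}"

text \<open>The default color of an edge between leg colors \<open>i\<close> and \<open>j\<close> is the third index.\<close>

definition up :: "'a \<Rightarrow> 'a \<Rightarrow> nat" where
  "up v u = (if v \<in> special then 1 else if v \<in> M \<or> u = parent v then (level v + 1) mod 3 else (level v + 2) mod 3)"

text \<open>Within level \<open>d\<close> the leg colors \<open>d\<close> and, after a move,
  \<open>d + 1\<close> meet, so the third index is \<open>d + 2\<close>.\<close>

definition ecol :: "'a \<Rightarrow> 'a \<Rightarrow> nat" where
  "ecol u v = (if level u = level v then (level u + 2) mod 3 else if level u < level v then up v u else up u v)"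

text \<open>A vertex with several legs that is not a root supplies the leg color of the next level
  itself. A root with two legs takes 0 and 2, because \<open>root_reach1\<close> supplies 1.\<close>

definition P :: "'a \<Rightarrow> nat set" where
  "P v = (if n v = 1 then {if v \<in> M then (level v + 1) mod 3 else level v mod 3}
     else if 0 < level v then {level v mod 3, (level v + 1) mod 3}
     else if n v = 2 then {0, 2} else {0, 1, 2})"

abbreviation reach :: "'a \<Rightarrow> nat \<Rightarrow> nat set \<Rightarrow> bool" where
  "reach \<equiv> exit R P ecol"

lemma reach0: "j \<in> P v \<Longrightarrow> reach v j B"
  and reach1: "R v u \<Longrightarrow> ecol v u \<in> B \<Longrightarrow> j \<in> P u \<Longrightarrow> reach v j B"
  and reach2: "R v u \<Longrightarrow> R u w \<Longrightarrow> ecol v u \<in> B \<Longrightarrow> ecol u w \<in> B \<Longrightarrow> ecol v u \<noteq> ecol u w \<Longrightarrow> j \<in> P w \<Longrightarrow> reach v j B"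
  unfolding exit_def by blast+

lemma ecol_sym: "ecol u v = ecol v u"
  by (auto simp: ecol_def)

lemma up_lt: "up v u < 3"
  by (auto simp: up_def)

lemma ecol_lt: "ecol u v < 3"
  using up_lt by (auto simp: ecol_def)

lemma ecol_up: "level v = Suc (level u) \<Longrightarrow> ecol v u = up v u" "level v = Suc (level u) \<Longrightarrow> ecol u v = up v u"
  by (auto simp: ecol_def)

lemma ecol_level: "level u = level v \<Longrightarrow> ecol u v = (level u + 2) mod 3"
  by (simp add: ecol_def)

lemma home: "v \<notin> M \<Longrightarrow> level v mod 3 \<in> P v"
  by (auto simp: P_def)

lemma home_M: "v \<in> M \<Longrightarrow> (level v + 1) mod 3 \<in> P v"
  using M_n by (auto simp: P_def)

lemma P_subset: "P v \<subseteq> {0, 1, 2}"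
proof -
  have "x mod 3 \<in> {0, 1, 2}" for x :: nat by auto
  then show ?thesis by (auto simp: P_def)
qed

lemma P_ne: "P v \<noteq> {}"
  by (auto simp: P_def)

lemma card_P: "v \<in> U \<Longrightarrow> card (P v) \<le> n v"
  using n_pos[of v] by (auto simp: P_def card_insert_if)

end

section \<open>Flexibility of every vertex of \<open>U\<close>\<close>

lemma mod3_triple: "{d mod 3, (d + 1) mod 3, (d + 2) mod 3} = {0, 1, 2 :: nat}"
  unfolding index_triple by (intro conjI) presburger+

lemma mod3_shift:
  "(d + 3) mod 3 = d mod (3::nat)" "(d + 4) mod 3 = (d + 1) mod (3::nat)"
  by presburger+

lemma mod3_neq: "d mod 3 \<noteq> (d + 1) mod (3::nat)"
  by presburger

lemma flexibleI:
  "X ((d + a) mod 3) {} \<Longrightarrow> X ((d + c) mod 3) {(d + b) mod 3} \<Longrightarrow> X ((d + b) mod 3) {(d + a) mod 3, (d + c) mod 3}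
    \<Longrightarrow> {a, b, c} = {0, 1, 2} \<Longrightarrow> flexible X"
proof -
  assume x: "X ((d + a) mod 3) {}" "X ((d + c) mod 3) {(d + b) mod 3}"
    "X ((d + b) mod 3) {(d + a) mod 3, (d + c) mod 3}" and abc: "{a, b, c} = {0, 1, 2}"
  have "{(d + a) mod 3, (d + b) mod 3, (d + c) mod 3} = (\<lambda>x. (d + x) mod 3) ` {a, b, c}" by simp
  also have "\<dots> = {0, 1, 2}" unfolding abc using mod3_triple[of d] by simp
  finally show ?thesis unfolding flexible_def using x by blast
qed

context moved_graph
begin

lemma special_level: "v \<in> special \<Longrightarrow> level v = 1"
  by (simp add: special_def)

lemma ecol_parent: "level v = Suc d \<Longrightarrow> v \<notin> special \<Longrightarrow> ecol v (parent v) = (d + 2) mod 3"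
  using parent(2)[of v d] ecol_up(1)[of v "parent v"] by (simp add: up_def)

lemma ecol_parent_special: "v \<in> special \<Longrightarrow> ecol v (parent v) = 1"
  using parent(2)[of v 0] ecol_up(1)[of v "parent v"] special_level[of v] by (simp add: up_def)

lemma reach_parent:
  assumes "level v = Suc d" "v \<notin> special"
  shows "reach v (d mod 3) {(d + 2) mod 3}"
  using parent[OF assms(1)] ecol_parent[OF assms] home[of "parent v"] by (intro reach1[of v "parent v"]) auto

text \<open>The root supplies leg color 0 over an edge of color 1. A member of \<open>M\<close> has
  leg color 2 and gets 1 from its partner over color 0; a branch has leg color 1 and gets 2 from
  level 2 over color 0.\<close>

lemma flexible_special:
  assumes v: "v \<in> special"
  shows "flexible (reach v)"
proof -
  note d = special_level[OF v]
  have 0: "reach v 0 {1}"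
    using parent[of v 0] ecol_parent_special[OF v] home[of "parent v"] d by (intro reach1[of v "parent v"]) auto
  show ?thesis
  proof (cases "v \<in> M")
    case True
    then obtain u where u: "R v u" "level u = level v" "u \<notin> M" using M_partner by blast
    have "reach v 1 {2, 0}"
      using u d home[of u] ecol_level[of v u] by (intro reach1[of v u]) auto
    moreover have "reach v 2 {}" using home_M[OF True] d by (intro reach0) (simp add: numeral_2_eq_2)
    ultimately show ?thesis using 0 by (intro flexibleI[of _ 0 2 0 1]) (auto simp: numeral_2_eq_2)
  next
    case False
    then have nd: "needy (root v)" and vc: "v = branch (root v)" using v by (auto simp: special_def)
    from branch[OF nd] vc obtain w where w: "R v w" "level w = 2" "w \<notin> M" by auto
    have rw: "root w = root v" using root_eq[OF w(1)] by simp
    have "parent w = v" using nd w R_sym[OF w(1)] vc by (simp add: parent_def rw)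
    moreover have "w \<notin> special" using w special_level by force
    ultimately have "ecol v w = 0" using w d ecol_parent[of w 1] ecol_sym[of v w] by simp
    then have "reach v 2 {0}" using w home[of w] by (intro reach1[of v w]) auto
    moreover have "reach v 1 {}" using home[OF False] d by (intro reach0) simp
    moreover have "reach v 0 {1, 2}" using 0 unfolding exit_def by blast
    ultimately show ?thesis by (intro flexibleI[of _ 0 1 2 0]) (auto simp: insert_commute numeral_2_eq_2)
  qed
qed

text \<open>The moved leg has color \<open>d + 2\<close>, the partner supplies \<open>d + 1\<close>
  over color \<open>d\<close>, and the parent supplies \<open>d\<close> over color
  \<open>d + 2\<close>.\<close>

lemma flexible_M:
  assumes v: "v \<in> M" "v \<notin> special" and d: "level v = Suc d"
  shows "flexible (reach v)"
proof -
  obtain u where u: "R v u" "level u = level v" "u \<notin> M" using M_partner[OF v(1)] by blast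
  have "reach v ((d + 1) mod 3) {(d + 0) mod 3}"
    using u d home[of u] ecol_level[of v u] by (intro reach1[of v u]) (auto simp: mod3_shift)
  moreover have "reach v ((d + 2) mod 3) {}" using home_M[OF v(1)] d by (intro reach0) simp
  moreover have "reach v ((d + 0) mod 3) {(d + 2) mod 3, (d + 1) mod 3}"
    using reach_parent[OF d v(2)] unfolding exit_def by fastforce
  ultimately show ?thesis by (intro flexibleI[of _ d 2 1 0]) auto
qed

text \<open>A child outside \<open>M\<close> has leg color \<open>d + 2\<close>, and its edge to
  \<open>v\<close> has color \<open>d\<close> or \<open>d + 1\<close>, depending on whether
  \<open>v\<close> is its parent. A child in \<open>M\<close> has given up this leg color, but its
  partner has it.\<close>

lemma reach_down:
  assumes v: "level v = Suc d" "v \<notin> M" and u: "R v u" "level u = Suc (Suc d)"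
  shows "reach v ((d + 2) mod 3) {(d + 1) mod 3, d mod 3}"
proof -
  have nSp: "u \<notin> special" using u special_level by force
  show ?thesis
  proof (cases "u \<in> M")
    case False
    have "ecol v u = up u v" using ecol_up(2)[of u v] u v by simp
    then have "ecol v u \<in> {(d + 1) mod 3, d mod 3}"
      using nSp u(2) by (auto simp: up_def mod3_shift add.commute)
    then show ?thesis using u home[OF False] by (intro reach1[of v u]) auto
  next
    case True
    then obtain w where w: "R u w" "level w = level u" "w \<notin> M" using M_partner by blast
    \<comment> \<open>For a child in \<open>M\<close> the color is \<open>d\<close> whether or not
      \<open>v\<close> is its parent, so it never clashes with the color \<open>d + 1\<close> of the
      edge to the partner.\<close>
    have "ecol v u = d mod 3" using ecol_up(2)[of u v] u v True nSp by (simp add: up_def mod3_shift)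
    moreover have "ecol u w = (d + 1) mod 3" using ecol_level[of u w] w u mod3_shift(2)[of d] by (simp add: add.commute)
    ultimately show ?thesis
      using u w home[of w] mod3_neq[of d] by (intro reach2[of v u w]) auto
  qed
qed

text \<open>There is an upward neighbor \<open>a\<close> besides the parent, and the parent of
  \<open>a\<close>, on level \<open>d - 1\<close>, has a leg of color \<open>d + 2\<close> modulo
  3.\<close>

lemma reach_second_up:
  assumes v: "v \<in> U" "level v = Suc d" "v \<notin> M" "v \<notin> special" "n v = 1"
    and no: "\<And>u. R v u \<Longrightarrow> level u = d"
  shows "reach v ((d + 2) mod 3) {(d + 1) mod 3, d mod 3}"
proof -
  obtain a where a: "R v a" "a \<noteq> parent v" using two_nbrs[OF v(1,5)] by blast
  have da: "level a = d" using no[OF a(1)] .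
  have root: "root a = root v" "root (parent v) = root v" using root_eq[OF a(1)] root_eq[OF parent(1)[OF v(2)]] by auto
  \<comment> \<open>A vertex of level 1 has only the root above it.\<close>
  have "d \<noteq> 0"
  proof
    assume "d = 0"
    then have "root a = a" "root (parent v) = parent v" using root_root da parent(2)[OF v(2)] by auto
    with root a(2) show False by simp
  qed
  then obtain f where f: "d = Suc f" using not0_implies_Suc by blast
  have aM: "a \<notin> M" using up_notin_M[OF a(1)] v(2) da by simp
  have aSp: "a \<notin> special"
  proof
    assume s: "a \<in> special"
    then have "needy (root v)" "a = branch (root v)" using aM root by (auto simp: special_def)
    moreover have "level v = 2" using special_level[OF s] da v(2) by simp
    ultimately have "parent v = a" using a(1) by (simp add: parent_def)
    with a(2) show False by simp
  qed
  have pa: "R a (parent a)" "level (parent a) = f" "parent a \<notin> M" using parent[of a f] da f by auto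
  \<comment> \<open>As \<open>a\<close> is not the parent of \<open>v\<close>, the edge has color
    \<open>d\<close>: this avoids both the forbidden \<open>d + 2\<close> and the color
    \<open>d + 1\<close> of the next edge.\<close>
  have 1: "ecol v a = d mod 3"
    using ecol_up(1)[of v a] v da a(2) by (simp add: up_def mod3_shift)
  have 2: "ecol a (parent a) = (d + 1) mod 3"
    using ecol_parent[of a f] da f aSp by simp
  have "f mod 3 \<in> P (parent a)" using home[OF pa(3)] pa(2) by simp
  moreover have "d + 2 = f + 3" using f by simp
  ultimately have "(d + 2) mod 3 \<in> P (parent a)" by (simp only: mod3_shift(1))
  then show ?thesis using a(1) pa(1) 1 2 mod3_neq[of d] by (intro reach2[of v a "parent a"]) auto
qed

text \<open>The leg has color \<open>d + 1\<close> and the parent supplies \<open>d\<close>, which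
  leaves leg color \<open>d + 2\<close> to be reached without edge color \<open>d + 2\<close>. Its
  source is a second leg, a child, a neighbor in \<open>M\<close> on the same level, or the parent
  of a second upward neighbor.\<close>

lemma flexible_nonroot:
  assumes v: "v \<in> U" "level v = Suc d" "v \<notin> M" "v \<notin> special"
  shows "flexible (reach v)"
proof -
  have "reach v ((d + 2) mod 3) {(d + 1) mod 3, d mod 3}"
  proof (cases "n v = 1")
    case False
    then have "(d + 2) mod 3 \<in> P v" using v by (simp add: P_def)
    then show ?thesis by (rule reach0)
  next
    case n: True
    show ?thesis
    proof (cases "\<exists>u. R v u \<and> level u = Suc (Suc d)")
      case True
      then show ?thesis using reach_down[OF v(2,3)] by blast
    next
      case no_down: False
      show ?thesis
      proof (cases "\<exists>u. R v u \<and> level u = Suc d")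
        case True
        then have "v \<in> pending - M" using v n no_down by (auto simp: pending_def)
        then obtain u where u: "u \<in> M" "R v u" "level u = Suc d" using M_max v(2) by force
        then show ?thesis
          using home_M[OF u(1)] ecol_level[of v u] v(2)
          by (intro reach1[of v u]) (auto simp: mod3_shift)
      next
        case no_level: False
        have "level u = d" if "R v u" for u
        proof -
          have "level u \<le> Suc (Suc d)" "Suc d \<le> Suc (level u)" using level_step[OF that] level_step[OF R_sym[OF that]] v(2) by auto
          moreover have "level u \<noteq> Suc (Suc d)" "level u \<noteq> Suc d" using that no_down no_level by auto
          ultimately show ?thesis by linarith
        qed
        then show ?thesis by (rule reach_second_up[OF v n])
      qed
    qed
  qed
  moreover have "reach v ((d + 1) mod 3) {}" using home[OF v(3)] v(2) by (intro reach0) simp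
  moreover have "reach v ((d + 0) mod 3) {(d + 2) mod 3}" using reach_parent[OF v(2,4)] by simp
  ultimately show ?thesis by (intro flexibleI[of _ d 1 0 2]) auto
qed

text \<open>A neighbor outside \<open>M\<close> and \<open>special\<close> has leg color 1 and an
  edge of color 2 to the root. A needy root has a neighbor besides its branch; for other roots only
  neighbors in \<open>M\<close> are special, and their partners are neighbors of the root
  too.\<close>

lemma root_reach1:
  assumes v: "v \<in> U" "level v = 0" and u: "R v u"
  shows "reach v 1 {2}"
proof -
  have rM: "root x = v" if "R v x" for x using root_nbr(2)[OF v(2) that] .
  have "\<exists>w. R v w \<and> w \<notin> M \<and> w \<notin> special"
  proof (cases "needy v")
    case True
    then have "n v = 1" by (simp add: needy_def)
    then obtain w where w: "R v w" "w \<noteq> branch v" using two_nbrs[OF v(1)] by blast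
    moreover have "w \<notin> M" using True w by (auto simp: needy_def)
    ultimately show ?thesis using rM[OF w(1)] by (auto simp: special_def)
  next
    case False
    have "\<exists>w. R v w \<and> w \<notin> M"
    proof (cases "u \<in> M")
      case True
      obtain w where w: "R u w" "level w = level u" "w \<notin> M" using M_partner[OF True] by blast
      then have "level w = 1" "root w = v" using root_nbr[OF v(2) u] root_eq[OF w(1)] by auto
      then show ?thesis using level1_root[of w] w(3) by auto
    qed (use u in blast)
    then show ?thesis using False rM by (auto simp: special_def)
  qed
  then obtain w where w: "R v w" "w \<notin> M" "w \<notin> special" by blast
  have dw: "level w = Suc 0" using root_nbr(1)[OF v(2) w(1)] by simp
  have "parent w = v"
  proof -
    have "level (parent w) = 0" "R w (parent w)" using parent[OF dw] by auto
    then show ?thesis using root_root[of "parent w"] root_eq[of w "parent w"] rM[OF w(1)] by simp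
  qed
  then have "ecol v w = 2" using ecol_parent[OF dw w(3)] ecol_sym[of v w] by simp
  then show ?thesis using w home[OF w(2)] dw by (intro reach1[of v w]) auto
qed

text \<open>A neighbor in \<open>M\<close> has leg color 2 and an edge of color 1 to the root. A
  needy root passes through its branch to level 2, over colors 1 and 0.\<close>

lemma root_reach2:
  assumes v: "v \<in> U" "level v = 0" "n v = 1"
  shows "reach v 2 {1, 0}"
proof (cases "needy v")
  case False
  then obtain u where u: "u \<in> M" "R v u" using v by (auto simp: needy_def)
  have du: "level u = 1" using root_nbr(1)[OF v(2) u(2)] .
  then have "u \<in> special" using u by (simp add: special_def)
  then have "ecol v u = 1" using ecol_up(2)[of u v] du v(2) by (simp add: up_def)
  then show ?thesis using u home_M[OF u(1)] du by (intro reach1[of v u]) (auto simp: numeral_2_eq_2)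
next
  case True
  define u where "u = branch v"
  from branch[OF True] obtain w where u: "R v u" "level u = 1" and w: "R u w" "level w = 2" "w \<notin> M"
    unfolding u_def by blast
  have root: "root u = v" "root w = v" using root_nbr(2)[OF v(2) u(1)] root_eq[OF w(1)] by auto
  have "u \<in> special" using u root True by (simp add: special_def u_def)
  then have 1: "ecol v u = 1" using ecol_up(2)[of u v] u(2) v(2) by (simp add: up_def)
  have "parent w = u" using True w R_sym[OF w(1)] root by (simp add: parent_def u_def)
  moreover have "w \<notin> special" using w special_level by force
  ultimately have "ecol u w = 0" using w ecol_parent[of w 1] ecol_sym[of u w] by simp
  then show ?thesis using u w 1 home[OF w(3)] by (intro reach2[of v u w]) auto
qed

lemma flexible_root:
  assumes v: "v \<in> U" "level v = 0"
  shows "flexible (reach v)"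
proof -
  have vM: "v \<notin> M" using M_level v(2) by force
  then have r0: "reach v 0 {}" using home v(2) by (intro reach0) fastforce
  show ?thesis
  proof (cases "3 \<le> n v")
    case True
    then have "reach v 1 {2}" "reach v 2 {0, 1}" using v(2) by (auto intro!: reach0 simp: P_def)
    then show ?thesis using r0 by (intro flexibleI[of _ 0 0 1 2]) (auto simp: insert_commute numeral_2_eq_2)
  next
    case False
    then have "card {u. R v u} \<noteq> 0" using deg[OF v(1)] by simp
    then obtain u where u: "R v u" by fastforce
    note r1 = root_reach1[OF v u]
    have "reach v 2 {1, 0}"
    proof (cases "n v = 1")
      case False
      with \<open>\<not> 3 \<le> n v\<close> n_pos[OF v(1)] have "n v = 2" by simp
      then show ?thesis using v(2) by (auto intro!: reach0 simp: P_def)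
    qed (rule root_reach2[OF v])
    then show ?thesis using r0 r1 by (intro flexibleI[of _ 0 0 1 2]) (auto simp: insert_commute numeral_2_eq_2)
  qed
qed

lemma flexible_reach: "v \<in> U \<Longrightarrow> flexible (reach v)"
  using flexible_special flexible_M flexible_nonroot flexible_root by (metis not0_implies_Suc)

end

lemma (in legged_graph) ex_flexible_exits:
  obtains P \<beta> where "\<And>v. v \<in> U \<Longrightarrow> card (P v) \<le> n v" "\<And>v. P v \<subseteq> {0, 1, 2}" "\<And>v. P v \<noteq> {}"
    "\<And>e. \<beta> e < 3" "\<And>v. v \<in> U \<Longrightarrow> flexible (exit R P (\<lambda>u w. \<beta> {u, w}) v)"
proof -
  obtain root level where "\<And>u v. R u v \<Longrightarrow> root u = root v" "\<And>u v. R u v \<Longrightarrow> level v \<le> Suc (level u)"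
    "\<And>v. level v = 0 \<Longrightarrow> root v = v" "\<And>v d. level v = Suc d \<Longrightarrow> \<exists>u. R v u \<and> level u = d"
    "\<And>v. n (root v) = 1 \<Longrightarrow> n v = 1"
    by (rule levels) blast
  then interpret leveled_graph U R n root level by unfold_locales
  obtain M where "M \<subseteq> pending" "\<And>u v. u \<in> M \<Longrightarrow> v \<in> M \<Longrightarrow> R u v \<Longrightarrow> level u \<noteq> level v"
    "\<And>v. v \<in> pending - M \<Longrightarrow> \<exists>u\<in>M. R v u \<and> level u = level v"
    by (rule ex_maximal_independent) blast
  then interpret moved_graph U R n root level M by unfold_locales
  \<comment> \<open>By symmetry of \<open>ecol\<close>, any ordered pair representing an edge yields
    its color.\<close>
  define \<beta> where "\<beta> e = (let p = SOME p. e = {fst p, snd p} in ecol (fst p) (snd p))" for e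
  have \<beta>: "\<beta> {u, v} = ecol u v" for u v
  proof -
    define p where "p = (SOME p. {u, v} = {fst p, snd p})"
    have "\<exists>p. {u, v} = {fst p, snd p}" by (rule exI[of _ "(u, v)"]) simp
    then have "{u, v} = {fst p, snd p}" unfolding p_def by (rule someI_ex)
    then have "ecol (fst p) (snd p) = ecol u v" using ecol_sym by (auto simp: doubleton_eq_iff)
    then show ?thesis by (simp add: \<beta>_def p_def Let_def)
  qed
  have "\<beta> e < 3" for e using ecol_lt by (simp add: \<beta>_def Let_def)
  then show thesis
    using card_P P_subset P_ne flexible_reach by (intro that[of P \<beta>]) (auto simp: \<beta>)
qed

subsection \<open>The upper bound\<close>

lemma induced_simps [simp]:
  "verts (induced_subgraph G D) = D" "edges (induced_subgraph G D) = {e \<in> edges G. e \<subseteq> D}"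
  by (simp_all add: induced_subgraph_def)

lemma flexible_mono:
  assumes "\<And>j B. X j B \<Longrightarrow> Y j B" "flexible X"
  shows "flexible Y"
proof -
  obtain h j k where "{h, j, k} = {0, 1, 2}" "X h {}" "X k {j}" "X j {h, k}"
    using assms(2) by (auto simp only: flexible_def)
  then show ?thesis unfolding flexible_def
    by (intro exI[of _ h] exI[of _ j] exI[of _ k] conjI assms(1))
qed

text \<open>Serves to color the legs of \<open>v\<close> with exactly the colors in
  \<open>P v\<close>.\<close>

lemma ex_image_eq:
  assumes "finite A" "finite B" "B \<noteq> {}" "card B \<le> card A"
  shows "\<exists>f. f ` A = B"
proof -
  obtain g where g: "g ` B \<subseteq> A" "inj_on g B"
    using card_le_inj[OF assms(2,1,4)] by blast
  obtain b where b: "b \<in> B" using assms(3) by blast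
  define f where "f a = (if a \<in> g ` B then inv_into B g a else b)" for a
  have "f ` A \<subseteq> B" using b by (auto simp: f_def inv_into_f_f[OF g(2)])
  moreover have "x \<in> f ` A" if x: "x \<in> B" for x
  proof (rule image_eqI)
    show "x = f (g x)" using x by (simp add: f_def inv_into_f_f[OF g(2)])
    show "g x \<in> A" using g(1) x by blast
  qed
  ultimately show ?thesis by blast
qed

lemma card_le_3_subset:
  assumes "S \<subseteq> V" "card S \<le> 3" "finite S" "V \<noteq> {}"
  obtains x y z where "x \<in> V" "y \<in> V" "z \<in> V" "S \<subseteq> {x, y, z}"
proof -
  obtain v where v: "v \<in> V" using assms(4) by blast
  have "card S = 0 \<or> card S = 1 \<or> card S = 2 \<or> card S = 3" using assms(2) by linarith
  then consider "S = {}" | "card S = 1" | "card S = 2" | "card S = 3"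
    using assms(3) card_0_eq by blast
  then show thesis
  proof cases
    case 1
    then show thesis using that[OF v v v] by simp
  next
    case 2
    then obtain x where "S = {x}" by (auto simp: card_1_singleton_iff)
    then show thesis using that[of x x x] assms(1) by simp
  next
    case 3
    then obtain x y where "S = {x, y}" by (auto simp: card_2_iff)
    then show thesis using that[of x x y] assms(1) by simp
  next
    case 4
    then obtain x y z where "S = {x, y, z}" by (auto simp: card_3_iff)
    then show thesis using that[of x y z] assms(1) by simp
  qed
qed

lemma rx3_le_dominating:
  fixes G :: "'a ugraph"
  assumes conG: "connected_graph G" and D: "connected_three_way_dominating_set G D"
  shows "rx3 G \<le> rx3 (induced_subgraph G D) + 6"
proof -
  let ?H = "induced_subgraph G D"
  have G: "simple_graph G" using conG by (simp add: connected_graph_def)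
  have conH: "connected_graph ?H" and dom: "dominating_set G D"
    and deg3: "\<And>v. v \<in> verts G - D \<Longrightarrow> 3 \<le> degree G v"
    using D by (auto simp: connected_three_way_dominating_set_def three_way_dominating_set_def)
  have DV: "D \<subseteq> verts G" and finV: "finite (verts G)" and finE: "finite (edges G)"
    using dom G simple_graph_finite_edges by (auto simp: dominating_set_def simple_graph_def)
  obtain c0 where c0: "rainbow3_coloring ?H c0" "card (c0 ` edges ?H) = rx3 ?H"
    using rx3_attained[OF conH] .
  \<comment> \<open>New colors start at \<open>K\<close>, above all colors on the edges of
    \<open>?H\<close>; the element 0 keeps the maximum meaningful if there are no such
    edges.\<close>
  define K where "K = Suc (Max (insert 0 (c0 ` edges ?H)))"
  have K: "c0 e < K" if "e \<in> edges ?H" for e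
  proof -
    have "c0 e \<in> insert 0 (c0 ` edges ?H)" using that by blast
    then have "c0 e \<le> Max (insert 0 (c0 ` edges ?H))" using finE by (intro Max_ge) auto
    then show ?thesis by (simp add: K_def)
  qed
  define U where "U = verts G - D"
  define R where "R u v \<longleftrightarrow> adj G u v \<and> u \<in> U \<and> v \<in> U" for u v
  define N where "N v = {u \<in> D. adj G v u}" for v
  have adjV: "u \<in> verts G \<and> v \<in> verts G \<and> u \<noteq> v" if "adj G u v" for u v
  proof -
    from that G have "{u, v} \<subseteq> verts G" "card {u, v} = 2" unfolding adj_def simple_graph_def by blast+
    then show ?thesis by auto
  qed
  have adj_sym: "adj G u v \<Longrightarrow> adj G v u" for u v by (simp add: adj_def insert_commute)
  have finN: "finite (N v)" for v using finV DV by (auto simp: N_def intro: finite_subset)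
  interpret legged_graph U R "\<lambda>v. card (N v)"
  proof
    show "finite U" using finV by (simp add: U_def)
    show "R v u" if "R u v" for u v using that adj_sym by (auto simp: R_def)
    show "\<not> R v v" for v using adjV by (auto simp: R_def)
    show "u \<in> U" if "R u v" for u v using that by (simp add: R_def)
    fix v assume v: "v \<in> U"
    then have "N v \<noteq> {}" using dom by (auto simp: U_def dominating_set_def N_def)
    then show "1 \<le> card (N v)" using finN[of v] by (simp add: Suc_le_eq card_gt_0_iff)
    have "{u. adj G v u} \<subseteq> N v \<union> {u. R v u}" using v adjV by (auto simp: U_def N_def R_def)
    moreover have "finite {u. R v u}" using finV by (rule rev_finite_subset) (auto simp: R_def U_def)
    ultimately have "degree G v \<le> card (N v \<union> {u. R v u})"
      unfolding degree_def using finN[of v] by (intro card_mono) auto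
    also have "\<dots> \<le> card (N v) + card {u. R v u}" by (rule card_Un_le)
    finally show "3 \<le> card (N v) + card {u. R v u}" using deg3[of v] v by (simp add: U_def)
  qed
  obtain P \<beta> where P: "\<And>v. v \<in> U \<Longrightarrow> card (P v) \<le> card (N v)" "\<And>v. P v \<subseteq> {0, 1, 2}" "\<And>v. P v \<noteq> {}"
    and \<beta>: "\<And>e. \<beta> e < 3" and flex: "\<And>v. v \<in> U \<Longrightarrow> flexible (exit R P (\<lambda>u w. \<beta> {u, w}) v)"
    using ex_flexible_exits by metis
  have "\<exists>f. v \<in> U \<longrightarrow> f ` N v = P v" for v
    using ex_image_eq[OF finN finite_subset[OF P(2)] P(3) P(1)] by auto
  then obtain leg where leg: "\<And>v. v \<in> U \<Longrightarrow> leg v ` N v = P v" by metis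
  \<comment> \<open>Legs get \<open>K\<close> to \<open>K + 2\<close>, edges inside \<open>U\<close>
    get \<open>K + 3\<close> to \<open>K + 5\<close>. A leg meets \<open>U\<close> and
    \<open>D\<close> in one vertex each, which \<open>the_elem\<close> extracts.\<close>
  define c where "c e = (if e \<subseteq> D then c0 e else if e \<subseteq> U then K + 3 + \<beta> e
    else K + leg (the_elem (e \<inter> U)) (the_elem (e \<inter> D)))" for e
  have cD: "c e = c0 e" if "e \<subseteq> D" for e using that by (simp add: c_def)
  have cU: "c {u, v} = K + 3 + \<beta> {u, v}" if "u \<in> U" "v \<in> U" for u v
    using that by (auto simp: c_def U_def)
  have cL: "c {v, u} = K + leg v u" if "v \<in> U" "u \<in> D" for u v
  proof -
    have "{v, u} \<inter> U = {v}" "{v, u} \<inter> D = {u}" using that by (auto simp: U_def)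
    moreover have "\<not> {v, u} \<subseteq> D" "\<not> {v, u} \<subseteq> U" using that by (auto simp: U_def)
    ultimately show ?thesis by (simp only: c_def if_False the_elem_eq)
  qed
  define palette where "palette j B = insert (K + j) ((\<lambda>b. K + 3 + b) ` B)" for j B
  define Ex where "Ex v j B \<longleftrightarrow> (\<exists>f F. f \<in> D \<and> F \<subseteq> edges G \<and> joined F v f \<and> inj_on c F \<and>
    c ` F \<subseteq> palette j B)" for v j B
  have leg_edge: "\<exists>f\<in>D. {v, f} \<in> edges G \<and> c {v, f} = K + j" if "v \<in> U" "j \<in> P v" for v j
  proof -
    have "j \<in> leg v ` N v" using that leg by simp
    then obtain f where "f \<in> N v" "leg v f = j" by (elim imageE) simp
    then show ?thesis using cL[OF that(1), of f] by (auto simp: N_def adj_def)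
  qed
  have j3: "j < 3" if "j \<in> P v" for j v using P(2)[of v] that by auto
  have Ex_exit: "Ex v j B" if v: "v \<in> U" and e: "exit R P (\<lambda>u w. \<beta> {u, w}) v j B" for v j B
    using e unfolding exit_def
  proof (elim disjE exE conjE)
    assume j: "j \<in> P v"
    from leg_edge[OF v j] obtain f where f: "f \<in> D" "{v, f} \<in> edges G" "c {v, f} = K + j" by blast
    then show ?thesis unfolding Ex_def palette_def by (intro exI[of _ f] exI[of _ "{{v, f}}"]) auto
  next
    fix u assume u: "R v u" "\<beta> {v, u} \<in> B" and j: "j \<in> P u"
    from u have uU: "u \<in> U" "{v, u} \<in> edges G" by (auto simp: R_def adj_def)
    from leg_edge[OF uU(1) j] obtain f where f: "f \<in> D" "{u, f} \<in> edges G" "c {u, f} = K + j" by blast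
    have "joined {{v, u}, {u, f}} v f"
      by (rule rtranclp_trans[of _ v u]) auto
    then show ?thesis unfolding Ex_def palette_def
      by (intro exI[of _ f] exI[of _ "{{v, u}, {u, f}}"])
        (use f u uU cU[OF v uU(1)] j3[OF j] in \<open>auto simp: inj_on_def\<close>)
  next
    fix u w assume u: "R v u" "\<beta> {v, u} \<in> B" and w: "R u w" "\<beta> {u, w} \<in> B" and ne: "\<beta> {v, u} \<noteq> \<beta> {u, w}"
      and j: "j \<in> P w"
    from u w have uU: "u \<in> U" "w \<in> U" "{v, u} \<in> edges G" "{u, w} \<in> edges G" by (auto simp: R_def adj_def)
    from leg_edge[OF uU(2) j] obtain f where f: "f \<in> D" "{w, f} \<in> edges G" "c {w, f} = K + j" by blast
    have "joined {{v, u}, {u, w}, {w, f}} v f"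
      by (rule converse_rtranclp_into_rtranclp[of _ v u], simp,
          rule converse_rtranclp_into_rtranclp[of _ u w]) auto
    then show ?thesis unfolding Ex_def palette_def
      by (intro exI[of _ f] exI[of _ "{{v, u}, {u, w}, {w, f}}"])
        (use f u w ne uU cU[OF v uU(1)] cU[OF uU(1,2)] j3[OF j] in \<open>auto simp: inj_on_def\<close>)
  qed
  have flexEx: "flexible (Ex v)" if "v \<in> verts G" for v
  proof (cases "v \<in> D")
    case True
    \<comment> \<open>A vertex of \<open>D\<close> is the end of its own exit, which has no
      edges.\<close>
    then have "Ex v j B" for j B unfolding Ex_def palette_def by (intro exI[of _ v] exI[of _ "{}"]) auto
    then show ?thesis unfolding flexible_def by blast
  next
    case False
    with that have v: "v \<in> U" by (simp add: U_def)
    show ?thesis using Ex_exit[OF v] flex[OF v] by (rule flexible_mono)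
  qed
  have "rainbow3_coloring G c"
    unfolding rainbow3_coloring_def
  proof (intro allI impI)
    fix S assume S: "S \<subseteq> verts G" "card S \<le> 3"
    have "verts G \<noteq> {}" using G by (simp add: simple_graph_def)
    then obtain x y z where xyz: "x \<in> verts G" "y \<in> verts G" "z \<in> verts G" and Sx: "S \<subseteq> {x, y, z}"
      using card_le_3_subset[OF S finite_subset[OF S(1) finV]] by metis
    \<comment> \<open>The three exits use disjoint sets of new colors; their ends in
      \<open>D\<close> are joined by a rainbow tree in old colors.\<close>
    obtain a b e A B C where abe: "a < 3" "b < 3" "e < 3" "a \<noteq> b" "b \<noteq> e" "a \<noteq> e"
      and ABC: "A \<inter> B = {}" "B \<inter> C = {}" "A \<inter> C = {}" and E: "Ex x a A" "Ex y b B" "Ex z e C"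
      using compatible_of_flexible[OF flexEx[OF xyz(1)] flexEx[OF xyz(2)] flexEx[OF xyz(3)]]
      unfolding compatible_def by blast
    obtain f1 F1 where 1: "f1 \<in> D" "F1 \<subseteq> edges G" "joined F1 x f1" "inj_on c F1"
      "c ` F1 \<subseteq> palette a A" using E(1) unfolding Ex_def by blast
    obtain f2 F2 where 2: "f2 \<in> D" "F2 \<subseteq> edges G" "joined F2 y f2" "inj_on c F2"
      "c ` F2 \<subseteq> palette b B" using E(2) unfolding Ex_def by blast
    obtain f3 F3 where 3: "f3 \<in> D" "F3 \<subseteq> edges G" "joined F3 z f3" "inj_on c F3"
      "c ` F3 \<subseteq> palette e C" using E(3) unfolding Ex_def by blast
    have "{f1, f2, f3} \<subseteq> verts ?H" "card {f1, f2, f3} \<le> 3"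
      using 1(1) 2(1) 3(1) by (auto simp: card_insert_if)
    then obtain T where T: "rainbow_tree ?H c0 T" and fT: "{f1, f2, f3} \<subseteq> verts T"
      using c0(1) unfolding rainbow3_coloring_def by blast
    have TE: "edges T \<subseteq> edges ?H" and inj0: "inj_on c0 (edges T)"
      and conT: "connected_graph T"
      using T by (auto simp: rainbow_tree_def subgraph_def is_tree_def)
    have TG: "edges T \<subseteq> edges G" using TE by auto
    have cT0: "c e = c0 e" "c0 e < K" if "e \<in> edges T" for e
      using subsetD[OF TE that] cD K by auto
    have injT: "inj_on c (edges T)" using inj0 cT0(1) inj_on_cong[of "edges T" c c0] by blast
    have cT: "c ` edges T \<subseteq> {..<K}" using cT0 by auto
    have palette: "palette i X \<inter> palette j Y = {}"
      if "i < 3" "j < 3" "i \<noteq> j" "X \<inter> Y = {}" for i j X Y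
      using that by (auto simp: palette_def)
    have paletteK: "palette i X \<subseteq> {K..}" for i X by (auto simp: palette_def)
    have i12: "c ` F1 \<inter> c ` F2 = {}"
      using 1(5) 2(5) palette[OF abe(1,2,4) ABC(1)] by blast
    have i123: "c ` (F1 \<union> F2) \<inter> c ` F3 = {}"
      using 1(5) 2(5) 3(5) palette[OF abe(2,3,5) ABC(2)] palette[OF abe(1,3,6) ABC(3)]
      unfolding image_Un by blast
    have "c ` (F1 \<union> F2 \<union> F3) \<subseteq> {K..}"
      unfolding image_Un
      by (intro Un_least order_trans[OF 1(5) paletteK] order_trans[OF 2(5) paletteK] order_trans[OF 3(5) paletteK])
    moreover have "{..<K} \<inter> {K..} = {}" by auto
    ultimately have iT: "c ` edges T \<inter> c ` (F1 \<union> F2 \<union> F3) = {}"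
      using cT by blast
    have inj_disj: "inj_on c (X \<union> Y)" if "inj_on c X" "inj_on c Y" "c ` X \<inter> c ` Y = {}" for X Y
      using that by (auto simp: inj_on_Un)
    define F where "F = edges T \<union> (F1 \<union> F2 \<union> F3)"
    have "inj_on c F" unfolding F_def
      by (intro inj_disj injT 1(4) 2(4) 3(4) i12 i123 iT)
    moreover have "F \<subseteq> edges G" using TG 1(2) 2(2) 3(2) by (simp add: F_def)
    moreover have "joined F f1 s" if "s \<in> S" for s
    proof -
      have JT: "joined F f1 g" if "g \<in> {f1, f2, f3}" for g
      proof -
        have "joined (edges T) f1 g" using conT fT that by (auto simp: connected_graph_def adj_eq)
        then show ?thesis by (rule joined_mono) (simp add: F_def)
      qed
      have J: "joined F g s" if "joined F' s g" "F' \<subseteq> F" for g F'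
        using joined_mono[OF that] by (rule joined_sym)
      have "s = x \<or> s = y \<or> s = z" using that Sx by blast
      then show ?thesis
        using rtranclp_trans[OF JT J] 1(3) 2(3) 3(3) unfolding F_def by (metis Un_upper1 Un_upper2 insertI1 insertI2 le_supI2 le_supI1)
    qed
    ultimately show "\<exists>T. rainbow_tree G c T \<and> S \<subseteq> verts T"
      using 1(1) DV by (intro rainbow_tree_of_joined[OF G]) auto
  qed
  then have "rx3 G \<le> card (c ` edges G)"
    unfolding rx3_def by (intro Least_le) blast
  also have "\<dots> \<le> card (c0 ` edges ?H \<union> {K..<K + 6})"
  proof (rule card_mono)
    show "finite (c0 ` edges ?H \<union> {K..<K + 6})" using finE by simp
    show "c ` edges G \<subseteq> c0 ` edges ?H \<union> {K..<K + 6}"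
    proof
      fix k assume "k \<in> c ` edges G"
      then obtain e where e: "e \<in> edges G" "k = c e" by blast
      with G have "e \<subseteq> verts G" "card e = 2" by (auto simp: simple_graph_def)
      then obtain u v where uv: "e = {u, v}" "u \<in> verts G" "v \<in> verts G" by (auto simp: card_2_iff)
      have leg3: "leg x y < 3" if "x \<in> U" "{x, y} \<in> edges G" "y \<in> D" for x y
      proof (rule j3)
        have "leg x y \<in> leg x ` N x" using that by (simp add: N_def adj_def)
        then show "leg x y \<in> P x" using leg[OF that(1)] by simp
      qed
      consider "e \<subseteq> D" | "u \<in> U" "v \<in> U" | "u \<in> U" "v \<in> D" | "u \<in> D" "v \<in> U"
        using uv by (auto simp: U_def)
      then show "k \<in> c0 ` edges ?H \<union> {K..<K + 6}"
      proof cases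
        case 1
        then show ?thesis using e cD by auto
      next
        case 2
        then show ?thesis using e uv cU \<beta>[of e] by simp
      next
        case 3
        then show ?thesis using e uv cL leg3[of u v] by fastforce
      next
        case 4
        then show ?thesis using e uv cL[of v u] leg3[of v u] by (fastforce simp: insert_commute)
      qed
    qed
  qed
  also have "\<dots> \<le> card (c0 ` edges ?H) + card {K..<K + 6}" by (rule card_Un_le)
  finally show ?thesis using c0(2) by simp
qed

subsection \<open>Tightness: windmills\<close>

definition K4 :: "nat set set" where
  "K4 = {e. e \<subseteq> {..3} \<and> card e = 2}"

text \<open>Position 3 of each copy of \<open>K4\<close> is the common hub 0; the other positions
  are numbered injectively from 1.\<close>

definition blade :: "nat \<Rightarrow> nat \<Rightarrow> nat" where
  "blade p s = (if s = 3 then 0 else 3 * p + s + 1)"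

definition windmill :: "nat \<Rightarrow> nat ugraph" where
  "windmill m = \<lparr>verts = {blade p s | p s. p < m \<and> s \<le> 3}, edges = {blade p ` e | p e. p < m \<and> e \<in> K4}\<rparr>"

lemma blade_eq_iff: "s \<le> 3 \<Longrightarrow> t \<le> 3 \<Longrightarrow> blade p s = blade q t \<longleftrightarrow> s = t \<and> (s = 3 \<or> p = q)"
  unfolding blade_def by (cases "s = 3"; cases "t = 3") (simp_all, presburger)

lemma inj_blade: "inj_on (blade p) {..3}"
  by (auto simp: inj_on_def blade_eq_iff)

lemma finite_K4: "finite K4"
  by (rule finite_subset[of _ "Pow {..3}"]) (auto simp: K4_def)

lemma card_K4: "card K4 = 6"
  unfolding K4_def by (subst n_subsets) (simp_all add: choose_two)

lemma pair_in_K4: "s \<le> 3 \<Longrightarrow> t \<le> 3 \<Longrightarrow> s \<noteq> t \<Longrightarrow> {s, t} \<in> K4"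
  by (simp add: K4_def)

lemma K4_less:
  assumes "e \<in> K4" "t \<in> e" "t \<noteq> 3"
  shows "t < 3"
proof -
  have "t \<le> 3" using assms(1,2) by (auto simp: K4_def)
  with assms(3) show ?thesis by simp
qed

lemma K4_ex_less:
  assumes "e \<in> K4"
  obtains s where "s \<in> e" "s < 3"
proof -
  have "\<not> e \<subseteq> {3}"
  proof
    assume "e \<subseteq> {3}"
    then have "card e \<le> card {3 :: nat}" by (rule card_mono[rotated]) simp
    with assms show False by (simp add: K4_def)
  qed
  then show thesis using that K4_less[OF assms] by blast
qed

lemma card_star:
  assumes "v \<le> 3"
  shows "card {e \<in> K4. v \<in> e} = 3"
proof -
  have "{e \<in> K4. v \<in> e} = (\<lambda>u. {v, u}) ` ({..3} - {v})"
    using assms by (auto simp: K4_def card_2_iff)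
  moreover have "inj_on (\<lambda>u. {v, u}) ({..3} - {v})"
    by (auto simp: inj_on_def doubleton_eq_iff)
  ultimately show ?thesis using assms by (simp add: card_image)
qed

lemma blade_image_eq:
  assumes "e \<in> K4" "e' \<in> K4" "blade p ` e = blade q ` e'"
  shows "p = q \<and> e = e'"
proof -
  obtain s where s: "s \<in> e" "s \<noteq> 3" using K4_ex_less[OF assms(1)] by (metis less_irrefl)
  have sub: "e \<subseteq> {..3}" "e' \<subseteq> {..3}" using assms by (auto simp: K4_def)
  have "blade p s \<in> blade q ` e'" using s assms(3) by blast
  then obtain t where "t \<in> e'" "blade p s = blade q t" by blast
  then have "p = q" using blade_eq_iff[of s t p q] s sub by auto
  then show ?thesis using assms(3) inj_on_image_eq_iff[OF inj_blade sub] by simp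
qed

lemma windmill_simple: "0 < m \<Longrightarrow> simple_graph (windmill m)"
proof -
  assume m: "0 < m"
  let ?V = "{blade p s | p s. p < m \<and> s \<le> 3}"
  have "?V = (\<lambda>(p, s). blade p s) ` ({..<m} \<times> {..3})" by auto
  then have "finite ?V" by simp
  moreover have "blade p ` e \<subseteq> ?V \<and> card (blade p ` e) = 2"
    if "p < m" "e \<in> K4" for p e
    using that card_image[OF inj_on_subset[OF inj_blade, of e p]] by (auto simp: K4_def)
  moreover have "?V \<noteq> {}" using m by blast
  ultimately show ?thesis unfolding simple_graph_def windmill_def ugraph.simps by blast
qed

lemma windmill_edge: "p < m \<Longrightarrow> e \<in> K4 \<Longrightarrow> blade p ` e \<in> edges (windmill m)"
  by (auto simp: windmill_def)

lemma windmill_adj: "p < m \<Longrightarrow> s \<le> 3 \<Longrightarrow> t \<le> 3 \<Longrightarrow> s \<noteq> t \<Longrightarrow> adj (windmill m) (blade p s) (blade p t)"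
  using pair_in_K4[of s t] by (auto simp: adj_def windmill_def intro!: exI[of _ p] exI[of _ "{s, t}"])

lemma blade_hub [simp]: "blade p 3 = 0"
  by (simp add: blade_def)

lemma windmill_verts: "v \<in> verts (windmill m) \<longleftrightarrow> (\<exists>p s. v = blade p s \<and> p < m \<and> s \<le> 3)"
  by (auto simp: windmill_def)

lemma windmill_hub: "v \<in> verts (windmill m) \<Longrightarrow> (adj (windmill m))\<^sup>*\<^sup>* v 0"
proof -
  assume "v \<in> verts (windmill m)"
  then obtain p s where "v = blade p s" "p < m" "s \<le> 3" by (auto simp: windmill_verts)
  then show ?thesis using windmill_adj[of p m s 3] by (cases "s = 3") auto
qed

lemma windmill_connected:
  assumes "0 < m"
  shows "connected_graph (windmill m)"
  unfolding connected_graph_def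
proof (intro conjI ballI windmill_simple[OF assms])
  fix u v assume "u \<in> verts (windmill m)" "v \<in> verts (windmill m)"
  then show "(adj (windmill m))\<^sup>*\<^sup>* u v"
    using windmill_hub[of u m] joined_sym[of "edges (windmill m)" v 0] windmill_hub[of v m]
    by (simp add: adj_eq)
qed

lemma induced_hub:
  assumes "0 < m"
  shows "induced_subgraph (windmill m) {0} = \<lparr>verts = {0}, edges = {}\<rparr>"
proof -
  have "\<not> e \<subseteq> {0}" if "e \<in> edges (windmill m)" for e
  proof
    assume "e \<subseteq> {0}"
    then have "card e \<le> card {0 :: nat}" by (rule card_mono[rotated]) simp
    then show False using windmill_simple[OF assms] that by (auto simp: simple_graph_def)
  qed
  then show ?thesis by (auto simp: induced_subgraph_def)
qed

lemma windmill_dominating: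
  assumes m: "0 < m"
  shows "connected_three_way_dominating_set (windmill m) {0}"
proof -
  have "\<exists>u\<in>{0}. adj (windmill m) v u" and "3 \<le> degree (windmill m) v"
    if "v \<in> verts (windmill m) - {0}" for v
  proof -
    from that obtain p s where ps: "v = blade p s" "p < m" "s \<le> 3"
      by (auto simp: windmill_verts)
    moreover have "s \<noteq> 3" using that ps(1) by auto
    ultimately have v: "v = blade p s" "p < m" "s \<le> 3" "s \<noteq> 3" by simp_all
    show "\<exists>u\<in>{0}. adj (windmill m) v u" using windmill_adj[of p m s 3] v by simp
    have sub: "blade p ` ({..3} - {s}) \<subseteq> {u. adj (windmill m) v u}"
      using windmill_adj[of p m s] v by auto
    have "{u. adj (windmill m) v u} \<subseteq> verts (windmill m)"
      using windmill_simple[OF m] by (auto simp: simple_graph_def adj_def)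
    then have "finite {u. adj (windmill m) v u}"
      using windmill_simple[OF m] by (auto simp: simple_graph_def intro: finite_subset)
    from card_mono[OF this sub] show "3 \<le> degree (windmill m) v"
      using v card_image[OF inj_on_subset[OF inj_blade, of "{..3} - {s}" p]] by (simp add: degree_def)
  qed
  moreover have "0 \<in> verts (windmill m)"
    using m unfolding windmill_verts by (intro exI[of _ 0] exI[of _ 3]) simp
  moreover have "connected_graph (induced_subgraph (windmill m) {0})"
    unfolding induced_hub[OF m] using singleton_is_tree[of "0 :: nat"] by (simp add: is_tree_def)
  ultimately show ?thesis
    by (simp add: connected_three_way_dominating_set_def three_way_dominating_set_def dominating_set_def)
qed

section \<open>Windmills need six colors\<close>

lemma joined_cut:
  assumes "joined F a b" "a \<in> X" "b \<notin> X"
  shows "\<exists>u v. {u, v} \<in> F \<and> u \<in> X \<and> v \<notin> X"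
  using assms by induction blast+

text \<open>Positions in \<open>W\<close> avoid the hub, so all edges at them belong to their own
  blade; to reach another blade the tree must leave \<open>W\<close> by such an edge.\<close>

lemma windmill_cut:
  assumes T: "subgraph T (windmill m)" "connected_graph T"
    and v: "blade p x \<in> verts T" "blade q x \<in> verts T" "p \<noteq> q" and x: "x \<in> W" "W \<subseteq> {..<3}"
  shows "\<exists>e\<in>K4. blade p ` e \<in> edges T \<and> e \<inter> W \<noteq> {} \<and> \<not> e \<subseteq> W"
proof -
  have "joined (edges T) (blade p x) (blade q x)"
    using T(2) v by (simp add: connected_graph_def adj_eq)
  moreover have "blade q x \<notin> blade p ` W"
  proof
    assume "blade q x \<in> blade p ` W"
    then obtain w where "w \<in> W" "blade q x = blade p w" by blast
    then show False using blade_eq_iff[of x w q p] x v(3) by force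
  qed
  ultimately obtain u w where uw: "{u, w} \<in> edges T" "u \<in> blade p ` W" "w \<notin> blade p ` W"
    using joined_cut[of "edges T" "blade p x" "blade q x" "blade p ` W"] x(1) by blast
  then have "{u, w} \<in> edges (windmill m)" using T(1) by (auto simp: subgraph_def)
  then obtain k e where e: "{u, w} = blade k ` e" "e \<in> K4" by (auto simp: windmill_def)
  obtain s where s: "u = blade p s" "s \<in> W" using uw(2) by blast
  obtain s' where s': "s' \<in> e" "u = blade k s'" using e(1) by blast
  have "s' \<le> 3" using s' e(2) by (auto simp: K4_def)
  then have "s = s'" "k = p" using blade_eq_iff[of s s' p k] s s' x by force+
  then have "blade p ` e \<in> edges T" "e \<inter> W \<noteq> {}" "\<not> e \<subseteq> W"
    using e(1) uw(1,3) s(2) s'(1) by auto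
  then show ?thesis using e(2) by blast
qed

lemma subset_Un_of_disjoint:
  assumes L: "card L = 3" and d: "A \<inter> B = {}" "B \<inter> C = {}" "A \<inter> C = {}"
    and ne: "A \<inter> L \<noteq> {}" "B \<inter> L \<noteq> {}" "C \<inter> L \<noteq> {}"
  shows "L \<subseteq> A \<union> B \<union> C"
proof -
  obtain a b c where abc: "a \<in> A" "a \<in> L" "b \<in> B" "b \<in> L" "c \<in> C" "c \<in> L" using ne by blast
  then have "a \<noteq> b" "b \<noteq> c" "a \<noteq> c" using d by auto
  then have "card {a, b, c} = card L" using L by simp
  moreover have "finite L" using L by (simp add: card_ge_0_finite)
  ultimately have "{a, b, c} = L" using abc by (intro card_subset_eq) auto
  with abc show ?thesis by blast
qed

text \<open>If three blades are colored alike, then joining their copies of a vertex \<open>x\<close> by a rainbow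
  tree uses, up to position, every edge incident with \<open>x\<close> or with the hub.\<close>

lemma alike_blades_inj_on:
  assumes T: "rainbow_tree (windmill m) c T" and x: "x < 3"
    and v: "blade p x \<in> verts T" "blade q x \<in> verts T" "blade r x \<in> verts T" and ne: "p \<noteq> q" "q \<noteq> r" "p \<noteq> r"
    and \<gamma>: "\<And>i e. i \<in> {p, q, r} \<Longrightarrow> e \<in> K4 \<Longrightarrow> c (blade i ` e) = \<gamma> e"
  shows "inj_on \<gamma> {e \<in> K4. x \<in> e \<or> 3 \<in> e}"
proof -
  \<comment> \<open>Positions in \<open>K4\<close> of the tree edges of blade \<open>i\<close>,
    which makes the three blades comparable.\<close>
  define F where "F i = {e \<in> K4. blade i ` e \<in> edges T}" for i
  have T': "subgraph T (windmill m)" "connected_graph T" and inj: "inj_on c (edges T)"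
    using T by (auto simp: rainbow_tree_def is_tree_def)
  have cut: "\<exists>e\<in>F i. e \<inter> W \<noteq> {} \<and> \<not> e \<subseteq> W" if "i \<in> {p, q, r}" "x \<in> W" "W \<subseteq> {..<3}" for i W
  proof -
    obtain j where "j \<in> {p, q, r}" "i \<noteq> j" using that(1) ne by blast
    then show ?thesis using windmill_cut[OF T', of i x j W] that v by (auto simp: F_def)
  qed
  have F_inj: "i = j \<and> e = e'"
    if "i \<in> {p, q, r}" "j \<in> {p, q, r}" "e \<in> F i" "e' \<in> F j" "\<gamma> e = \<gamma> e'" for i j e e'
  proof -
    have "blade i ` e = blade j ` e'"
      using inj that \<gamma>[of i e] \<gamma>[of j e'] by (intro inj_onD[OF inj]) (auto simp: F_def)
    then show ?thesis using that blade_image_eq[of e e' i j] by (auto simp: F_def)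
  qed
  \<comment> \<open>One position in two blades would mean two tree edges of equal color.\<close>
  have disj: "F i \<inter> F j = {}" if "i \<in> {p, q, r}" "j \<in> {p, q, r}" "i \<noteq> j" for i j
    using F_inj[OF that(1,2)] that(3) by blast
  have star: "{e \<in> K4. y \<in> e} \<subseteq> F p \<union> F q \<union> F r"
    if "y \<le> 3" "\<And>i. i \<in> {p, q, r} \<Longrightarrow> F i \<inter> {e \<in> K4. y \<in> e} \<noteq> {}" for y
    using card_star[OF that(1)] disj ne that(2) by (intro subset_Un_of_disjoint) auto
  \<comment> \<open>The cuts around \<open>x\<close> alone and around all positions but the hub show
    that each blade uses an edge at \<open>x\<close> and one at the hub. Each star has three edges,
    so the three disjoint sets exhaust it.\<close>
  have "F i \<inter> {e \<in> K4. x \<in> e} \<noteq> {}" if "i \<in> {p, q, r}" for i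
    using cut[OF that, of "{x}"] x by (auto simp: F_def)
  moreover have "F i \<inter> {e \<in> K4. 3 \<in> e} \<noteq> {}" if i: "i \<in> {p, q, r}" for i
  proof -
    obtain e where e: "e \<in> F i" "\<not> e \<subseteq> {..<3}" using cut[OF i, of "{..<3}"] x by auto
    then have "3 \<in> e" using K4_less[of e] by (auto simp: F_def)
    then show ?thesis using e by (auto simp: F_def)
  qed
  ultimately have "{e \<in> K4. x \<in> e \<or> 3 \<in> e} \<subseteq> F p \<union> F q \<union> F r"
    using star[of x] star[of 3] x by auto
  then have used: "\<exists>i\<in>{p, q, r}. e \<in> F i" if "e \<in> {e \<in> K4. x \<in> e \<or> 3 \<in> e}" for e
    using that by blast
  show ?thesis
  proof (rule inj_onI)
    fix e e' assume e: "e \<in> {e \<in> K4. x \<in> e \<or> 3 \<in> e}" "e' \<in> {e \<in> K4. x \<in> e \<or> 3 \<in> e}" "\<gamma> e = \<gamma> e'"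
    obtain i j where "i \<in> {p, q, r}" "e \<in> F i" "j \<in> {p, q, r}" "e' \<in> F j"
      using used[OF e(1)] used[OF e(2)] by blast
    then show "e = e'" using F_inj[of i j e e'] e(3) by simp
  qed
qed

lemma pigeonhole3:
  assumes "finite A" "finite B" "f ` A \<subseteq> B" "2 * card B < card A"
  obtains p q r where "p \<in> A" "q \<in> A" "r \<in> A" "p \<noteq> q" "q \<noteq> r" "p \<noteq> r" "f p = f q" "f q = f r"
proof -
  have "\<exists>y\<in>B. 3 \<le> card {x \<in> A. f x = y}"
  proof (rule ccontr)
    assume "\<not> ?thesis"
    then have le: "card {x \<in> A. f x = y} \<le> 2" if "y \<in> B" for y using that by force
    have "A = (\<Union>y\<in>B. {x \<in> A. f x = y})" using assms(3) by blast
    then have "card A \<le> (\<Sum>y\<in>B. card {x \<in> A. f x = y})"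
      using card_UN_le[OF assms(2), of "\<lambda>y. {x \<in> A. f x = y}"] by simp
    also have "\<dots> \<le> (\<Sum>y\<in>B. 2)" using le by (rule sum_mono)
    finally show False using assms(4) by simp
  qed
  then obtain y X where "X \<subseteq> {x \<in> A. f x = y}" "card X = 3"
    using obtain_subset_with_card_n by metis
  then show thesis using that by (auto simp: card_3_iff)
qed

lemma windmill_colors:
  assumes m: "2 * 5 ^ 6 < m" and c: "rainbow3_coloring (windmill m) c"
  shows "6 \<le> card (c ` edges (windmill m))"
proof (rule ccontr)
  define C where "C = c ` edges (windmill m)"
  assume "\<not> ?thesis"
  then have C5: "card C \<le> 5" by (simp add: C_def)
  have finC: "finite C"
    using simple_graph_finite_edges[OF windmill_simple, of m] m by (simp add: C_def)
  define f where "f p = (\<lambda>e\<in>K4. c (blade p ` e))" for p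
  have "f ` {..<m} \<subseteq> K4 \<rightarrow>\<^sub>E C" by (auto simp: f_def C_def intro!: imageI windmill_edge)
  \<comment> \<open>The six edges of a blade have at most \<open>5 ^ 6\<close> colorings, so more
    than twice as many blades include three alike.\<close>
  moreover have "card (K4 \<rightarrow>\<^sub>E C) \<le> 5 ^ 6"
    using power_mono[OF C5, of 6] by (simp add: card_PiE finite_K4 card_K4)
  then have "2 * card (K4 \<rightarrow>\<^sub>E C) < card {..<m}" using m by simp
  moreover have "finite (K4 \<rightarrow>\<^sub>E C)" using finite_K4 finC by (simp add: finite_PiE)
  ultimately obtain p q r where "p \<in> {..<m}" "q \<in> {..<m}" "r \<in> {..<m}"
    and ne: "p \<noteq> q" "q \<noteq> r" "p \<noteq> r" and f: "f p = f q" "f q = f r"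
    using pigeonhole3[OF finite_lessThan] by metis
  then have pqr: "p < m" "q < m" "r < m" by simp_all
  define \<gamma> where "\<gamma> = f p"
  have \<gamma>: "c (blade i ` e) = \<gamma> e" if "i \<in> {p, q, r}" "e \<in> K4" for i e
  proof -
    have "\<gamma> = f i" using f that(1) by (auto simp: \<gamma>_def)
    then show ?thesis using that(2) by (simp add: f_def)
  qed
  have star: "inj_on \<gamma> {e \<in> K4. x \<in> e \<or> 3 \<in> e}" if x: "x < 3" for x
  proof -
    have "{blade p x, blade q x, blade r x} \<subseteq> verts (windmill m)"
      using pqr x by (auto simp: windmill_verts intro: less_imp_le)
    moreover have "card {blade p x, blade q x, blade r x} \<le> 3" by (simp add: card_insert_if)
    ultimately obtain T where "rainbow_tree (windmill m) c T" "{blade p x, blade q x, blade r x} \<subseteq> verts T"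
      using c unfolding rainbow3_coloring_def by blast
    then show ?thesis using alike_blades_inj_on[of m c T x p q r \<gamma>] x ne \<gamma> by simp
  qed
  \<comment> \<open>Two edges avoiding the hub lie in a triangle and meet in some \<open>x\<close>;
    if one contains the hub, a vertex of the other serves. So injectivity on the sets in
    \<open>star\<close> gives injectivity on \<open>K4\<close>.\<close>
  have common: "\<exists>x<3. (x \<in> e \<or> 3 \<in> e) \<and> (x \<in> e' \<or> 3 \<in> e')" if e: "e \<in> K4" "e' \<in> K4" for e e'
  proof (rule ccontr)
    assume no: "\<not> ?thesis"
    have "3 \<notin> e" "3 \<notin> e'" using no K4_ex_less[OF e(1)] K4_ex_less[OF e(2)] by metis+
    then have sub: "e \<union> e' \<subseteq> {..<3}" using K4_less[OF e(1)] K4_less[OF e(2)] by force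
    then have "e \<inter> e' = {}" using no by blast
    moreover have "finite e" "finite e'" "card e = 2" "card e' = 2"
      using e by (auto simp: K4_def card_ge_0_finite)
    ultimately have "card (e \<union> e') = 4" by (simp add: card_Un_disjoint)
    then show False using card_mono[OF _ sub] by simp
  qed
  have "inj_on \<gamma> K4"
  proof (rule inj_onI)
    fix e e' assume e: "e \<in> K4" "e' \<in> K4" "\<gamma> e = \<gamma> e'"
    obtain x where "x < 3" "x \<in> e \<or> 3 \<in> e" "x \<in> e' \<or> 3 \<in> e'" using common[OF e(1,2)] by blast
    then show "e = e'" using inj_onD[OF star e(3)] e by blast
  qed
  then have "card (\<gamma> ` K4) = 6" by (simp add: card_image card_K4)
  moreover have "\<gamma> ` K4 \<subseteq> C"
    using \<gamma>[of p, symmetric] pqr(1) by (auto simp: C_def intro!: imageI windmill_edge)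
  ultimately show False using card_mono[OF finC, of "\<gamma> ` K4"] C5 by simp
qed

theorem theorem3:
  "(\<forall>(G :: 'a ugraph) D. connected_graph G \<and> connected_three_way_dominating_set G D \<longrightarrow>
      rx3 G \<le> rx3 (induced_subgraph G D) + 6) \<and>
   (\<exists>(G :: nat ugraph) D. connected_graph G \<and> connected_three_way_dominating_set G D \<and>
      rx3 G = rx3 (induced_subgraph G D) + 6)"
proof (intro conjI allI impI)
  fix G :: "'a ugraph" and D
  assume "connected_graph G \<and> connected_three_way_dominating_set G D"
  then show "rx3 G \<le> rx3 (induced_subgraph G D) + 6" using rx3_le_dominating by blast
next
  obtain m :: nat where m: "2 * 5 ^ 6 < m" by blast
  then have m0: "0 < m" by simp
  note con = windmill_connected[OF m0] and dom = windmill_dominating[OF m0]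
  have "rx3 (induced_subgraph (windmill m) {0}) = 0"
    unfolding induced_hub[OF m0] by (rule rx3_K1)
  moreover have "6 \<le> rx3 (windmill m)"
    using rx3_attained[OF con] windmill_colors[OF m] by metis
  \<comment> \<open>The reverse inequality is the upper bound applied to the hub, whose index is
    0.\<close>
  ultimately have "rx3 (windmill m) = rx3 (induced_subgraph (windmill m) {0}) + 6"
    using rx3_le_dominating[OF con dom] by simp
  with con dom show "\<exists>(G :: nat ugraph) D. connected_graph G \<and> connected_three_way_dominating_set G D \<and>
      rx3 G = rx3 (induced_subgraph G D) + 6"
    by blast
qed

end
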